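(* Let $n,d\ge1$ be integers and $\beta,h\ge0$ reals. Suppose there is no FPRAS for the partition function of a family $\mathcal{M}\in\{\hat{\mathcal{M}}^+_{\textsc{Potts}}(n,d,\beta,h),\hat{\mathcal{M}}^-_{\textsc{Ising}}(n,d,\beta,h),\hat{\mathcal{M}}^+_{\textsc{Ising}}(n,d,\beta,h)\}$. Then for any $c>0$ there is no polynomial-time algorithm for the decision version of $n^c$-approximate counting for $\mathcal{M}$.
   Context: A $q$-state Potts model $(G,\beta_G,h_G)$ on $G=(V,E)$ has weights $w(\sigma)=\exp\big(\sum_{\{u,v\}\in E}\beta_G(\{u,v\})\mathbb{1}(\sigma(u)=\sigma(v))+\sum_vh_G(v,\sigma(v))\big)$, $\sigma\in[q]^V$, and partition function $Z_{G,\beta_G,h_G}=\sum_\sigma w(\sigma)$; the Ising model is $q=2$. $\hat{\mathcal{M}}^+_{\textsc{Potts}}(n,d,\beta,h)$ is the family of ferromagnetic $q$-state Potts models on $n$-vertex graphs of maximum degree at most $d$ in which every edge weight equals $\beta$ and $|h_G(v,i)|\le h$; $\hat{\mathcal{M}}^+_{\textsc{Ising}}$ is the same with $q=2$; $\hat{\mathcal{M}}^-_{\textsc{Ising}}(n,d,\beta,h)$ is the corresponding antiferromagnetic Ising family in which every edge has the same weight of absolute value $\beta$ (i.e. weight $-\beta$). An FPRAS for $Z$ outputs, for any $\rho>0$, $\hat Z$ with $e^{-\rho}Z\le\hat Z\le e^\rho Z$ with probability at least $3/4$ in time $\mathrm{poly}(n,1/\rho)$. Decision $r$-approximate counting: given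 a model $(G,\beta_G,h_G)$, a ratio $r>1$ and $\hat Z\in\mathbb{R}$, distinguish with probability at least $5/8$ between (i) $Z_{G,\beta_G,h_G}\le\hat Z/r$ and (ii) $Z_{G,\beta_G,h_G}\ge r\hat Z$. *)

theory Defs
  imports "HOL-Probability.Probability"
begin

section \<open>Potts models\<close>

text \<open>The vertex set is \<open>{..<order}\<close> and the set of spins is \<open>{1..spins}\<close>. Values of \<open>beta\<close>
  outside \<open>edges\<close>, and of \<open>field\<close> outside vertices and spins, are irrelevant.\<close>

record potts =
  spins :: nat
  order :: nat
  edges :: "nat set set"
  beta :: "nat set \<Rightarrow> real"
  field :: "nat \<Rightarrow> nat \<Rightarrow> real"

definition simple_graph :: "nat \<Rightarrow> nat set set \<Rightarrow> bool" where
  "simple_graph n E \<longleftrightarrow> (\<forall>e\<in>E. e \<subseteq> {..<n} \<and> card e = 2)"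

definition max_degree_le :: "nat \<Rightarrow> nat set set \<Rightarrow> nat \<Rightarrow> bool" where
  "max_degree_le n E d \<longleftrightarrow> (\<forall>v<n. card {e\<in>E. v \<in> e} \<le> d)"

definition configurations :: "potts \<Rightarrow> (nat \<Rightarrow> nat) set" where
  "configurations M = {..<order M} \<rightarrow>\<^sub>E {1..spins M}"

definition weight :: "potts \<Rightarrow> (nat \<Rightarrow> nat) \<Rightarrow> real" where
  "weight M \<sigma> = exp ((\<Sum>e\<in>edges M. beta M e * of_bool (\<forall>u\<in>e. \<forall>v\<in>e. \<sigma> u = \<sigma> v))
                    + (\<Sum>v<order M. field M v (\<sigma> v)))"

definition partition_function :: "potts \<Rightarrow> real" where
  "partition_function M = (\<Sum>\<sigma>\<in>configurations M. weight M \<sigma>)"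

definition ferromagnetic :: "potts \<Rightarrow> bool" where
  "ferromagnetic M \<longleftrightarrow> (\<forall>e\<in>edges M. beta M e \<ge> 0)"

definition antiferromagnetic :: "potts \<Rightarrow> bool" where
  "antiferromagnetic M \<longleftrightarrow> (\<forall>e\<in>edges M. beta M e \<le> 0)"

definition bounded_models :: "nat \<Rightarrow> nat \<Rightarrow> nat \<Rightarrow> real \<Rightarrow> potts set" where
  "bounded_models q n d h =
     {M. spins M = q \<and> order M = n \<and> simple_graph n (edges M) \<and> max_degree_le n (edges M) d
         \<and> (\<forall>v<n. \<forall>i\<in>{1..q}. \<bar>field M v i\<bar> \<le> h)}"

definition potts_plus :: "nat \<Rightarrow> nat \<Rightarrow> nat \<Rightarrow> real \<Rightarrow> real \<Rightarrow> potts set" where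
  "potts_plus q n d \<beta> h =
     {M \<in> bounded_models q n d h. ferromagnetic M \<and> (\<forall>e\<in>edges M. beta M e = \<beta>)}"

definition ising_plus :: "nat \<Rightarrow> nat \<Rightarrow> real \<Rightarrow> real \<Rightarrow> potts set" where
  "ising_plus n d \<beta> h = potts_plus 2 n d \<beta> h"

definition ising_minus :: "nat \<Rightarrow> nat \<Rightarrow> real \<Rightarrow> real \<Rightarrow> potts set" where
  "ising_minus n d \<beta> h =
     {M \<in> bounded_models 2 n d h. antiferromagnetic M \<and> (\<forall>e\<in>edges M. beta M e = - \<beta>)}"

section \<open>Randomised algorithms over the reals\<close>

text \<open>Inputs (\<open>\<beta>\<^sub>G\<close>, \<open>h\<^sub>G\<close>, \<open>\<rho>\<close>, the ratio and the guess) are real numbers and running times depend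
  only on \<open>n\<close> and \<open>1/\<rho>\<close>, so the machine model is a unit-cost one over the reals in the style of
  Blum, Shub and Smale: finite programs with real constants, exact field operations and
  comparisons. \<open>exp\<close> and \<open>ln\<close> are also primitive, so that Gibbs weights and ratios \<open>n\<^sup>c\<close> can be
  computed; there is no rounding operation. Memory is organised as in Jones's WHILE language: each
  variable holds a binary tree, here with real atoms. Assignments copy references, hence unit
  cost; trees can only be inspected one node at a time. \<open>Nul\<close> stands for false, every other value
  for true. Randomness comes from fair coin flips.\<close>

datatype val = Nul | Atom real | Pair val val

type_synonym store = "nat \<Rightarrow> val"

datatype expr =
    Var nat
  | Const real
  | NulE
  | PairE expr expr
  | Fst expr
  | Snd expr
  | IsAtom expr
  | Less expr expr
  | Add expr expr
  | Sub expr expr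
  | Mul expr expr
  | Div expr expr
  | Exp expr
  | Ln expr

datatype com =
    Skip
  | Assign nat expr
  | Flip nat
  | Seq com com
  | Cond expr com com
  | While expr com

fun num :: "val \<Rightarrow> real" where
  "num (Atom x) = x"
| "num _ = 0"

fun left :: "val \<Rightarrow> val" where
  "left (Pair a b) = a"
| "left _ = Nul"

fun right :: "val \<Rightarrow> val" where
  "right (Pair a b) = b"
| "right _ = Nul"

fun is_atom :: "val \<Rightarrow> bool" where
  "is_atom (Atom x) = True"
| "is_atom _ = False"

definition truth :: "bool \<Rightarrow> val" where
  "truth b = (if b then Atom 1 else Nul)"

primrec evaluate :: "expr \<Rightarrow> store \<Rightarrow> val" where
  "evaluate (Var x) s = s x"
| "evaluate (Const r) s = Atom r"
| "evaluate NulE s = Nul"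
| "evaluate (PairE a b) s = Pair (evaluate a s) (evaluate b s)"
| "evaluate (Fst a) s = left (evaluate a s)"
| "evaluate (Snd a) s = right (evaluate a s)"
| "evaluate (IsAtom a) s = truth (is_atom (evaluate a s))"
| "evaluate (Less a b) s = truth (num (evaluate a s) < num (evaluate b s))"
| "evaluate (Add a b) s = Atom (num (evaluate a s) + num (evaluate b s))"
| "evaluate (Sub a b) s = Atom (num (evaluate a s) - num (evaluate b s))"
| "evaluate (Mul a b) s = Atom (num (evaluate a s) * num (evaluate b s))"
| "evaluate (Div a b) s = Atom (num (evaluate a s) / num (evaluate b s))"
| "evaluate (Exp a) s = Atom (exp (num (evaluate a s)))"
| "evaluate (Ln a) s = Atom (let x = num (evaluate a s) in if x > 0 then ln x else 0)"

text \<open>The expressions of a program are fixed, so charging one step per command agrees, up to a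
  constant factor depending only on the program, with charging one step per operation.\<close>

primrec step :: "com \<Rightarrow> store \<Rightarrow> (com \<times> store) pmf" where
  "step Skip s = return_pmf (Skip, s)"
| "step (Assign x a) s = return_pmf (Skip, s(x := evaluate a s))"
| "step (Flip x) s = map_pmf (\<lambda>b. (Skip, s(x := truth b))) (bernoulli_pmf (1/2))"
| "step (Seq c1 c2) s =
     (if c1 = Skip then return_pmf (c2, s)
      else map_pmf (\<lambda>(c, s'). (Seq c c2, s')) (step c1 s))"
| "step (Cond a c1 c2) s = return_pmf (if evaluate a s \<noteq> Nul then c1 else c2, s)"
| "step (While a c) s = return_pmf (if evaluate a s \<noteq> Nul then Seq c (While a c) else Skip, s)"

primrec steps :: "nat \<Rightarrow> com \<times> store \<Rightarrow> (com \<times> store) pmf" where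
  "steps 0 cs = return_pmf cs"
| "steps (Suc t) cs = bind_pmf (steps t cs) (\<lambda>(c, s). step c s)"

text \<open>Variable 0 holds the input initially and the output on termination.\<close>

definition run :: "com \<Rightarrow> val \<Rightarrow> nat \<Rightarrow> (com \<times> store) pmf" where
  "run p inp t = steps t (p, (\<lambda>x. Nul)(0 := inp))"

definition halts_within :: "com \<Rightarrow> val \<Rightarrow> nat \<Rightarrow> bool" where
  "halts_within p inp t \<longleftrightarrow> (\<forall>(c, s) \<in> set_pmf (run p inp t). c = Skip)"

definition output_dist :: "com \<Rightarrow> val \<Rightarrow> nat \<Rightarrow> val pmf" where
  "output_dist p inp t = map_pmf (\<lambda>(c, s). s 0) (run p inp t)"

section \<open>Approximate counting\<close>

primrec encode_list :: "val list \<Rightarrow> val" where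
  "encode_list [] = Nul"
| "encode_list (v # vs) = Pair v (encode_list vs)"

text \<open>One entry per vertex, consisting of its external fields and its row of the weighted adjacency
  matrix, in which \<open>Nul\<close> marks a non-edge.\<close>

definition encode_vertex :: "potts \<Rightarrow> nat \<Rightarrow> val" where
  "encode_vertex M v = Pair
     (encode_list (map (\<lambda>i. Atom (field M v i)) [1..<spins M + 1]))
     (encode_list (map (\<lambda>u. if {u, v} \<in> edges M then Atom (beta M {u, v}) else Nul) [0..<order M]))"

definition encode :: "potts \<Rightarrow> val" where
  "encode M = encode_list (map (encode_vertex M) [0..<order M])"

text \<open>Families are indexed by the number of vertices. As \<open>n \<ge> 1\<close>, the bound \<open>C (n + 1/\<rho>)\<^sup>k\<close>
  (below: \<open>C n\<^sup>k\<close>) is equivalent to an arbitrary polynomial bound in \<open>n\<close> and \<open>1/\<rho>\<close> (in \<open>n\<close>).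
  Halted configurations are fixed by \<^const>\<open>step\<close>, so the output distribution does not depend on
  the choice of \<open>t\<close>.\<close>

definition fpras :: "(nat \<Rightarrow> potts set) \<Rightarrow> com \<Rightarrow> bool" where
  "fpras \<M> p \<longleftrightarrow>
     (\<exists>C k. \<forall>n\<ge>1. \<forall>M\<in>\<M> n. \<forall>\<rho>>0. \<exists>t.
        let inp = Pair (Atom \<rho>) (encode M); Z = partition_function M in
        real t \<le> C * (real n + 1 / \<rho>) ^ k \<and> halts_within p inp t
        \<and> measure_pmf.prob (output_dist p inp t)
             {Atom z | z. exp (- \<rho>) * Z \<le> z \<and> z \<le> exp \<rho> * Z} \<ge> 3/4)"

text \<open>The answer \<open>Nul\<close> claims \<open>Z \<le> guess / r\<close>, any other answer claims \<open>Z \<ge> r * guess\<close>. The problem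
  is defined for ratios above 1 only, so nothing is asked for those \<open>n\<close> with \<open>r n \<le> 1\<close>
  (for \<open>r n = n\<^sup>c\<close> this is \<open>n = 1\<close>).\<close>

definition poly_time_decision :: "(nat \<Rightarrow> potts set) \<Rightarrow> (nat \<Rightarrow> real) \<Rightarrow> com \<Rightarrow> bool" where
  "poly_time_decision \<M> r p \<longleftrightarrow>
     (\<exists>C k. \<forall>n\<ge>1. r n > 1 \<longrightarrow> (\<forall>M\<in>\<M> n. \<forall>guess::real. \<exists>t.
        let inp = Pair (Atom (r n)) (Pair (Atom guess) (encode M)); Z = partition_function M in
        real t \<le> C * real n ^ k \<and> halts_within p inp t
        \<and> (Z \<le> guess / r n \<longrightarrow> measure_pmf.prob (output_dist p inp t) {Nul} \<ge> 5/8)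
        \<and> (Z \<ge> r n * guess \<longrightarrow> measure_pmf.prob (output_dist p inp t) (- {Nul}) \<ge> 5/8)))"

end

theory Submission
  imports Defs
begin

text \<open>Disjoint unions multiply partition functions, so the \<open>K\<close>-fold copy of a model, which stays
  in the family, has partition function \<open>Z\<^sup>K\<close>. A decision procedure with ratio \<open>(K n)\<^sup>c\<close>, applied to
  the copies with guess \<open>exp (K y)\<close>, therefore compares \<open>y\<close> with \<open>ln Z\<close> up to an error
  \<open>c ln (K n) / K\<close>, which is at most \<open>\<rho>/20\<close> for some \<open>K\<close> polynomial in \<open>n\<close> and \<open>1/\<rho>\<close>.

  The errors of the procedure are absorbed by a random walk instead of a binary search with majority
  votes: starting from \<open>y = 0\<close>, each answer moves \<open>y\<close> by \<open>\<rho>/20\<close> in the direction that it suggests.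
  In units of \<open>\<rho>/20\<close>, the potential \<open>\<Phi> = (4/3)\<^sup>x + (4/3)\<^sup>-\<^sup>x\<close> of the displacement \<open>x\<close> from \<open>ln Z\<close>
  satisfies \<open>E \<Phi>' \<le> 31/32 \<Phi> + 1\<close>. As \<open>ln Z = O(n\<^sup>2)\<close>, after \<open>O(n\<^sup>2/\<rho>)\<close> steps its expectation is at
  most 34, so that by Markov's inequality \<open>y\<close> is within \<open>\<rho>\<close> of \<open>ln Z\<close> with probability at least 3/4.\<close>

section \<open>Expectations of program runs\<close>

text \<open>The weakest preexpectation in \<open>t\<close> steps. Runs that have not halted by then count as \<open>\<top>\<close>; a
  finite value therefore certifies termination within \<open>t\<close> steps.\<close>

primrec wp :: "nat \<Rightarrow> com \<Rightarrow> (store \<Rightarrow> ennreal) \<Rightarrow> store \<Rightarrow> ennreal" where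
  "wp 0 c f s = (if c = Skip then f s else \<top>)"
| "wp (Suc t) c f s = (\<integral>\<^sup>+ (c', s'). wp t c' f s' \<partial>step c s)"

lemma steps_Suc_first: "steps (Suc t) cs = bind_pmf (case cs of (c, s) \<Rightarrow> step c s) (steps t)"
proof (induction t)
  case 0
  show ?case by (simp add: bind_return_pmf bind_return_pmf')
next
  case (Suc t)
  have "steps (Suc (Suc t)) cs = bind_pmf (steps (Suc t) cs) (\<lambda>(c, s). step c s)"
    by simp
  also have "\<dots> = bind_pmf (case cs of (c, s) \<Rightarrow> step c s)
      (\<lambda>cs'. bind_pmf (steps t cs') (\<lambda>(c, s). step c s))"
    unfolding Suc by (rule bind_assoc_pmf)
  also have "\<dots> = bind_pmf (case cs of (c, s) \<Rightarrow> step c s) (steps (Suc t))"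
    by (intro bind_pmf_cong refl) simp
  finally show ?case .
qed

lemma wp_eq_nn_integral_steps:
  "wp t c f s = (\<integral>\<^sup>+ (c', s'). (if c' = Skip then f s' else \<top>) \<partial>steps t (c, s))"
proof (induction t arbitrary: c s)
  case 0
  show ?case by simp
next
  case (Suc t)
  show ?case
    unfolding steps_Suc_first by (simp add: Suc case_prod_unfold)
qed

lemma wp_mono: "(\<And>s. f s \<le> g s) \<Longrightarrow> wp t c f s \<le> wp t c g s"
  by (induction t arbitrary: c s) (auto intro!: nn_integral_mono)

lemma wp_Skip [simp]: "wp t Skip f s = f s"
  by (induction t) auto

lemma wp_Suc_le: "wp (Suc t) c f s \<le> wp t c f s"
proof (induction t arbitrary: c s)
  case 0
  show ?case by simp
next
  case (Suc t)
  show ?case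
    by (subst (1 2) wp.simps(2)) (auto intro!: nn_integral_mono Suc simp del: wp.simps)
qed

lemma wp_antimono: "t \<le> t' \<Longrightarrow> wp t' c f s \<le> wp t c f s"
  by (rule lift_Suc_antimono_le[of "\<lambda>t. wp t c f s"]) (auto intro: wp_Suc_le simp del: wp.simps)

lemma wp_Assign: "wp (Suc t) (Assign x a) f = (\<lambda>s. f (s(x := evaluate a s)))"
  by (rule ext) simp

lemma wp_Cond:
  "wp (Suc t) (Cond a c1 c2) f s = wp t (if evaluate a s \<noteq> Nul then c1 else c2) f s"
  by simp

lemma wp_While:
  "wp (Suc t) (While a c) f s = (if evaluate a s \<noteq> Nul then wp t (Seq c (While a c)) f s else f s)"
  by simp

lemma wp_Seq: "wp (t1 + t2 + 1) (Seq c1 c2) f s \<le> wp t1 c1 (wp t2 c2 f) s"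
proof (induction t1 arbitrary: c1 s)
  case 0
  show ?case by simp
next
  case (Suc t1)
  show ?case
  proof (cases "c1 = Skip")
    case True
    then show ?thesis using wp_antimono[of t2 "Suc (t1 + t2)" c2 f s] by simp
  next
    case False
    have "wp (Suc t1 + t2 + 1) (Seq c1 c2) f s
        = (\<integral>\<^sup>+ (c', s'). wp (t1 + t2 + 1) (Seq c' c2) f s' \<partial>step c1 s)"
      using False by (simp add: case_prod_unfold del: wp.simps(2) add: wp.simps(2)[of "Suc (t1 + t2)"])
    also have "\<dots> \<le> (\<integral>\<^sup>+ (c', s'). wp t1 c' (wp t2 c2 f) s' \<partial>step c1 s)"
      using Suc by (auto intro!: nn_integral_mono simp del: wp.simps)
    finally show ?thesis by simp
  qed
qed

declare wp.simps(2) [simp del]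

lemma wp_While_le:
  assumes body: "\<And>k s. k < N \<Longrightarrow> J k s < \<top> \<Longrightarrow> evaluate b s \<noteq> Nul \<and> wp t c (J (Suc k)) s \<le> J k s"
    and exit: "\<And>s. J N s < \<top> \<Longrightarrow> evaluate b s = Nul \<and> f s \<le> J N s"
  shows "wp (N * (t + 2) + 1) (While b c) f s \<le> J 0 s"
proof -
  have "wp (j * (t + 2) + 1) (While b c) f s \<le> J (N - j) s" if "j \<le> N" for j s
    using that
  proof (induction j arbitrary: s)
    case 0
    show ?case
      using exit[of s] by (cases "J N s < \<top>") (auto simp: not_less top_unique wp_While)
  next
    case (Suc j)
    show ?case
    proof (cases "J (N - Suc j) s < \<top>")
      case True
      with body[of "N - Suc j" s] Suc.prems
      have enter: "evaluate b s \<noteq> Nul" and decrease: "wp t c (J (N - j)) s \<le> J (N - Suc j) s"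
        by (auto simp: Suc_diff_Suc)
      have "wp (Suc j * (t + 2) + 1) (While b c) f s
          = wp (t + (j * (t + 2) + 1) + 1) (Seq c (While b c)) f s"
        using enter by (simp add: wp_While algebra_simps)
      also have "\<dots> \<le> wp t c (wp (j * (t + 2) + 1) (While b c) f) s"
        by (rule wp_Seq)
      also have "\<dots> \<le> wp t c (J (N - j)) s"
        using Suc by (intro wp_mono) simp
      also note decrease
      finally show ?thesis .
    qed (simp add: not_less top_unique)
  qed
  from this[of N s] show ?thesis by simp
qed

abbreviation initial :: "val \<Rightarrow> store" where
  "initial inp \<equiv> (\<lambda>_. Nul)(0 := inp)"

lemma wp_output:
  assumes "halts_within p inp t"
  shows "wp t p (\<lambda>s. g (s 0)) (initial inp) = (\<integral>\<^sup>+ v. g v \<partial>output_dist p inp t)"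
  unfolding wp_eq_nn_integral_steps output_dist_def nn_integral_map_pmf
  using assms unfolding halts_within_def run_def
  by (intro nn_integral_cong_AE AE_pmfI) auto

lemma
  assumes error: "wp t p (\<lambda>s. indicator (- G) (s 0)) (initial inp) \<le> ennreal \<epsilon>" and "\<epsilon> \<ge> 0"
  shows halts_within_if_wp_le: "halts_within p inp t"
    and prob_output_ge_if_wp_le: "measure_pmf.prob (output_dist p inp t) G \<ge> 1 - \<epsilon>"
proof -
  let ?g = "\<lambda>(c, s). if c = Skip then indicator (- G) (s 0) else \<top> :: ennreal"
  have finite: "(\<integral>\<^sup>+ cs. ?g cs \<partial>run p inp t) \<noteq> \<infinity>"
    using error unfolding wp_eq_nn_integral_steps run_def by (auto simp: top_unique)
  have "AE cs in run p inp t. ?g cs \<noteq> \<infinity>"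
    by (rule nn_integral_noteq_infinite[OF _ finite]) simp
  then show halts: "halts_within p inp t"
    unfolding halts_within_def AE_measure_pmf_iff by (auto split: if_splits)
  have "wp t p (\<lambda>s. indicator (- G) (s 0)) (initial inp)
      = ennreal (measure_pmf.prob (output_dist p inp t) (- G))"
    unfolding wp_output[OF halts, of "indicator (- G)"] by (simp add: measure_pmf.emeasure_eq_measure)
  then have "measure_pmf.prob (output_dist p inp t) (- G) \<le> \<epsilon>"
    using assms by simp
  then show "measure_pmf.prob (output_dist p inp t) G \<ge> 1 - \<epsilon>"
    using measure_pmf.prob_compl[of G "output_dist p inp t"] by (auto simp: Compl_eq_Diff_UNIV)
qed

section \<open>Almost sure total correctness\<close>

definition barrier :: "(store \<Rightarrow> bool) \<Rightarrow> store \<Rightarrow> ennreal" where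
  "barrier Q s = (if Q s then 0 else \<top>)"

definition ensures :: "nat \<Rightarrow> com \<Rightarrow> (store \<Rightarrow> bool) \<Rightarrow> store \<Rightarrow> bool" where
  "ensures t c Q s \<longleftrightarrow> wp t c (barrier Q) s = 0"

lemma wp_barrier_le: "wp t c (barrier Q) s \<le> barrier (ensures t c Q) s"
  by (simp add: barrier_def ensures_def)

lemma ensures_mono:
  assumes "ensures t c Q s" "t \<le> t'" "\<And>s'. Q s' \<Longrightarrow> R s'"
  shows "ensures t' c R s"
proof -
  have "wp t' c (barrier R) s \<le> wp t c (barrier R) s"
    using assms(2) by (rule wp_antimono)
  also have "\<dots> \<le> wp t c (barrier Q) s"
    using assms(3) by (intro wp_mono) (simp add: barrier_def)
  finally show ?thesis using assms(1) by (simp add: ensures_def)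
qed

lemma wp_le_if_ensures:
  assumes "ensures t c Q s" "\<And>s'. Q s' \<Longrightarrow> f s' \<le> b"
  shows "wp t c f s \<le> b"
  using assms(1)
proof (induction t arbitrary: c s)
  case 0
  then show ?case using assms(2) by (auto simp: ensures_def barrier_def split: if_splits)
next
  case (Suc t)
  then have "ensures t c' Q s'" if "(c', s') \<in> set_pmf (step c s)" for c' s'
    using that
    by (auto simp: ensures_def wp.simps nn_integral_0_iff_AE AE_measure_pmf_iff)
  then have "wp (Suc t) c f s \<le> (\<integral>\<^sup>+ _. b \<partial>step c s)"
    unfolding wp.simps using Suc.IH by (intro nn_integral_mono_AE AE_pmfI) auto
  then show ?case by simp
qed

lemma ensures_Skip: "Q s \<Longrightarrow> ensures 0 Skip Q s"
  by (simp add: ensures_def barrier_def)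

lemma ensures_Assign [simp]:
  "ensures (Suc t) (Assign x a) Q = (\<lambda>s. Q (s(x := evaluate a s)))"
  by (simp add: ensures_def barrier_def wp_Assign fun_eq_iff)

lemma ensures_Cond:
  "ensures t (if evaluate a s \<noteq> Nul then c1 else c2) Q s \<Longrightarrow> ensures (Suc t) (Cond a c1 c2) Q s"
  by (simp add: ensures_def wp_Cond)

lemma ensures_Seq:
  assumes "ensures t1 c1 (ensures t2 c2 Q) s"
  shows "ensures (t1 + t2 + 1) (Seq c1 c2) Q s"
proof -
  have "wp (t1 + t2 + 1) (Seq c1 c2) (barrier Q) s \<le> wp t1 c1 (wp t2 c2 (barrier Q)) s"
    by (rule wp_Seq)
  also have "\<dots> \<le> wp t1 c1 (barrier (ensures t2 c2 Q)) s"
    by (rule wp_mono) (rule wp_barrier_le)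
  finally show ?thesis using assms by (simp add: ensures_def)
qed

lemma ensures_Seq_eq:
  "ensures t1 c1 (\<lambda>s'. s' = s1) s \<Longrightarrow> ensures t2 c2 Q s1 \<Longrightarrow> ensures (t1 + t2 + 1) (Seq c1 c2) Q s"
  by (rule ensures_Seq, erule ensures_mono) auto

lemma ensures_Assign_Seq:
  "ensures t c Q (s(x := evaluate a s)) \<Longrightarrow> ensures (t + 2) (Seq (Assign x a) c) Q s"
  using ensures_Seq[of 1 "Assign x a" t c Q s] by simp

lemma wp_Seq_le_if_ensures:
  assumes "ensures t1 c1 Q s" "\<And>s'. Q s' \<Longrightarrow> wp t2 c2 f s' \<le> b"
  shows "wp (t1 + t2 + 1) (Seq c1 c2) f s \<le> b"
  using wp_Seq wp_le_if_ensures[OF assms] by (rule order_trans)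

lemma ensures_While_exit: "evaluate b s = Nul \<Longrightarrow> Q s \<Longrightarrow> ensures (Suc t) (While b c) Q s"
  by (simp add: ensures_def barrier_def wp_While)

lemma ensures_While_enter:
  assumes "evaluate b s \<noteq> Nul" "ensures t1 c (ensures t2 (While b c) Q) s"
  shows "ensures (t1 + t2 + 2) (While b c) Q s"
  using ensures_Seq[OF assms(2)] assms(1) by (simp add: ensures_def wp_While)

section \<open>Loops\<close>

definition foreach :: "nat \<Rightarrow> com \<Rightarrow> com" where
  "foreach x c = While (Var x) (Seq c (Assign x (Snd (Var x))))"

lemma ensures_foreach_Nul: "s x = Nul \<Longrightarrow> Q s \<Longrightarrow> ensures (Suc t) (foreach x c) Q s"
  by (simp add: foreach_def ensures_While_exit)

lemma ensures_foreach_Pair: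
  assumes "s x = Pair v vs" "ensures t c (\<lambda>s'. ensures t' (foreach x c) Q (s'(x := right (s' x)))) s"
  shows "ensures (t + t' + 4) (foreach x c) Q s"
proof -
  have "ensures (t + 1 + 1) (Seq c (Assign x (Snd (Var x)))) (ensures t' (foreach x c) Q) s"
    using assms(2) by (intro ensures_Seq) simp
  then show ?thesis
    unfolding foreach_def using assms(1) by (intro ensures_mono[OF ensures_While_enter]) auto
qed

lemma ensures_foreach_Assign:
  assumes "x \<noteq> y" "s x = encode_list xs"
    and "\<And>z zs w. evaluate e (s(x := Pair z zs, y := w)) = g z w"
  shows "ensures (5 * length xs + 1) (foreach x (Assign y e))
    (\<lambda>s'. s' = s(x := Nul, y := fold g xs (s y))) s"
  using assms(2,3)
proof (induction xs arbitrary: s)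
  case Nil
  then have "s = s(x := Nul, y := s y)" by auto
  with Nil show ?case by (simp add: ensures_foreach_Nul del: fun_upd_apply)
next
  case (Cons z zs)
  let ?s = "s(x := encode_list zs, y := g z (s y))"
  have "s = s(x := Pair z (encode_list zs), y := s y)"
    using Cons.prems(1) by auto
  then have "evaluate e s = g z (s y)"
    by (metis Cons.prems(2))
  moreover have upd: "?s(x := v, y := w) = s(x := v, y := w)" for v w
    by auto
  have "ensures (5 * length zs + 1) (foreach x (Assign y e))
      (\<lambda>s'. s' = ?s(x := Nul, y := fold g zs (?s y))) ?s"
    by (rule Cons.IH) (simp_all only: upd Cons.prems(2), use assms(1) in simp)
  ultimately have "ensures (1 + (5 * length zs + 1) + 4) (foreach x (Assign y e))
      (\<lambda>s'. s' = s(x := Nul, y := fold g (z # zs) (s y))) s"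
    using Cons.prems(1) assms(1)
    by (intro ensures_foreach_Pair) (simp_all add: fun_upd_twist)
  then show ?case by (simp add: algebra_simps del: fun_upd_apply)
qed

lemma fold_increment: "fold (\<lambda>_ w. Atom (num w + 1)) xs (Atom x) = Atom (x + real (length xs))"
  by (induction xs arbitrary: x) simp_all

definition push :: "nat \<Rightarrow> expr \<Rightarrow> nat \<Rightarrow> com" where
  "push x e y = foreach x (Assign y (PairE e (Var y)))"

lemma fold_Pair_encode_list:
  "fold (\<lambda>z. Pair (f z)) xs (encode_list ys) = encode_list (rev (map f xs) @ ys)"
  by (induction xs arbitrary: ys) (simp_all flip: encode_list.simps(2))

lemma ensures_push:
  assumes "x \<noteq> y" "s x = encode_list xs" "s y = encode_list ys"
    and "\<And>z zs w. evaluate e (s(x := Pair z zs, y := w)) = f z"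
  shows "ensures (5 * length xs + 1) (push x e y)
    (\<lambda>s'. s' = s(x := Nul, y := encode_list (rev (map f xs) @ ys))) s"
  unfolding push_def fold_Pair_encode_list[symmetric] assms(3)[symmetric]
  using assms(1,2,4) by (intro ensures_foreach_Assign) simp_all

definition count_to :: "nat \<Rightarrow> nat \<Rightarrow> com \<Rightarrow> com" where
  "count_to i x c = Seq (Assign i (Const 0))
     (While (Less (Var i) (Var x)) (Seq c (Assign i (Add (Var i) (Const 1)))))"

lemma less_nat_ceiling_iff: "k < nat \<lceil>x\<rceil> \<longleftrightarrow> real k < x"
  by (simp add: zless_nat_eq_int_zless less_ceiling_iff)

lemma wp_count_to_le:
  fixes l :: real
  defines "N \<equiv> nat \<lceil>l\<rceil>"
  assumes counter: "\<And>k s. J k s < \<top> \<Longrightarrow> s i = Atom (real k) \<and> s x = Atom l"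
    and body: "\<And>k s. k < N \<Longrightarrow> J k s < \<top> \<Longrightarrow>
      wp t c (\<lambda>s'. J (Suc k) (s'(i := Atom (num (s' i) + 1)))) s \<le> J k s"
    and exit: "\<And>s. J N s < \<top> \<Longrightarrow> f s \<le> J N s"
  shows "wp (N * (t + 4) + 3) (count_to i x c) f s \<le> J 0 (s(i := Atom 0))"
proof -
  let ?W = "While (Less (Var i) (Var x)) (Seq c (Assign i (Add (Var i) (Const 1))))"
  have "wp (1 + (N * (t + 1 + 1 + 2) + 1) + 1) (count_to i x c) f s
      \<le> wp 1 (Assign i (Const 0)) (wp (N * (t + 1 + 1 + 2) + 1) ?W f) s"
    unfolding count_to_def by (rule wp_Seq)
  also have "\<dots> = wp (N * (t + 1 + 1 + 2) + 1) ?W f (s(i := Atom 0))"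
    by (simp add: wp_Assign)
  also have "\<dots> \<le> J 0 (s(i := Atom 0))"
  proof (rule wp_While_le)
    fix k s assume k: "k < N" and J: "J k s < \<top>"
    have "wp (t + 1 + 1) (Seq c (Assign i (Add (Var i) (Const 1)))) (J (Suc k)) s
        \<le> wp t c (wp 1 (Assign i (Add (Var i) (Const 1))) (J (Suc k))) s"
      by (rule wp_Seq)
    also have "\<dots> \<le> J k s"
      using body[OF k J] by (simp add: wp_Assign)
    finally show "evaluate (Less (Var i) (Var x)) s \<noteq> Nul
        \<and> wp (t + 1 + 1) (Seq c (Assign i (Add (Var i) (Const 1)))) (J (Suc k)) s \<le> J k s"
      using counter[OF J] k by (simp add: truth_def N_def less_nat_ceiling_iff)
  next
    fix s assume J: "J N s < \<top>"
    then show "evaluate (Less (Var i) (Var x)) s = Nul \<and> f s \<le> J N s"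
      using counter[OF J] exit less_nat_ceiling_iff[of N l] by (simp add: truth_def N_def)
  qed
  finally show ?thesis by (simp add: numeral_eq_Suc)
qed

lemma ensures_count_to:
  fixes l :: real
  defines "N \<equiv> nat \<lceil>l\<rceil>"
  assumes counter: "\<And>k s. I k s \<Longrightarrow> s i = Atom (real k) \<and> s x = Atom l"
    and body: "\<And>k s. k < N \<Longrightarrow> I k s \<Longrightarrow>
      ensures t c (\<lambda>s'. I (Suc k) (s'(i := Atom (num (s' i) + 1)))) s"
    and init: "I 0 (s(i := Atom 0))"
  shows "ensures (N * (t + 4) + 3) (count_to i x c) (I N) s"
proof -
  have "wp (N * (t + 4) + 3) (count_to i x c) (barrier (I N)) s \<le> barrier (I 0) (s(i := Atom 0))"
    unfolding N_def
  proof (rule wp_count_to_le)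
    fix k s assume k: "k < nat \<lceil>l\<rceil>" and "barrier (I k) s < \<top>"
    then have I: "I k s" by (auto simp: barrier_def split: if_splits)
    have "(\<lambda>s'. barrier (I (Suc k)) (s'(i := Atom (num (s' i) + 1))))
        = barrier (\<lambda>s'. I (Suc k) (s'(i := Atom (num (s' i) + 1))))"
      by (simp add: barrier_def fun_eq_iff)
    then show "wp t c (\<lambda>s'. barrier (I (Suc k)) (s'(i := Atom (num (s' i) + 1)))) s \<le> barrier (I k) s"
      using body[OF k[folded N_def] I] by (simp add: ensures_def)
  qed (use counter in \<open>auto simp: barrier_def split: if_splits\<close>)
  with init show ?thesis by (simp add: ensures_def barrier_def)
qed

section \<open>Subroutines\<close>

primrec evars :: "expr \<Rightarrow> nat set" where
  "evars (Var x) = {x}"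
| "evars (Const r) = {}"
| "evars NulE = {}"
| "evars (PairE a b) = evars a \<union> evars b"
| "evars (Fst a) = evars a"
| "evars (Snd a) = evars a"
| "evars (IsAtom a) = evars a"
| "evars (Less a b) = evars a \<union> evars b"
| "evars (Add a b) = evars a \<union> evars b"
| "evars (Sub a b) = evars a \<union> evars b"
| "evars (Mul a b) = evars a \<union> evars b"
| "evars (Div a b) = evars a \<union> evars b"
| "evars (Exp a) = evars a"
| "evars (Ln a) = evars a"

primrec cvars :: "com \<Rightarrow> nat set" where
  "cvars Skip = {}"
| "cvars (Assign x a) = insert x (evars a)"
| "cvars (Flip x) = {x}"
| "cvars (Seq c1 c2) = cvars c1 \<union> cvars c2"
| "cvars (Cond a c1 c2) = evars a \<union> cvars c1 \<union> cvars c2"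
| "cvars (While a c) = evars a \<union> cvars c"

lemma finite_evars: "finite (evars a)"
  by (induction a) auto

lemma finite_cvars: "finite (cvars c)"
  by (induction c) (auto simp: finite_evars)

text \<open>A subroutine runs in the variables below \<open>m\<close>, its caller keeps the remaining ones.\<close>

definition overlay :: "nat \<Rightarrow> store \<Rightarrow> store \<Rightarrow> store" where
  "overlay m s' s = (\<lambda>x. if x < m then s' x else s x)"

lemma overlay_apply [simp]:
  "x < m \<Longrightarrow> overlay m s' s x = s' x"
  "m \<le> x \<Longrightarrow> overlay m s' s x = s x"
  by (simp_all add: overlay_def)

lemma evaluate_overlay: "evars a \<subseteq> {..<m} \<Longrightarrow> evaluate a (overlay m s' s) = evaluate a s'"
  by (induction a) auto

lemma overlay_upd: "x < m \<Longrightarrow> (overlay m s' s)(x := v) = overlay m (s'(x := v)) s"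
  by (auto simp: overlay_def)

lemma step_overlay:
  "cvars c \<subseteq> {..<m} \<Longrightarrow>
    step c (overlay m s' s) = map_pmf (\<lambda>(c', s''). (c', overlay m s'' s)) (step c s')"
  by (induction c)
    (auto simp: evaluate_overlay overlay_upd pmf.map_comp o_def case_prod_unfold)

lemma cvars_step: "(c', s') \<in> set_pmf (step c s) \<Longrightarrow> cvars c' \<subseteq> cvars c"
  by (induction c arbitrary: c' s') (force split: if_splits)+

lemma wp_overlay:
  "cvars c \<subseteq> {..<m} \<Longrightarrow> wp t c f (overlay m s' s) = wp t c (\<lambda>s''. f (overlay m s'' s)) s'"
proof (induction t arbitrary: c s')
  case 0
  show ?case by simp
next
  case (Suc t)
  have "wp t c' f (overlay m s'' s) = wp t c' (\<lambda>s''. f (overlay m s'' s)) s''"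
    if "(c', s'') \<in> set_pmf (step c s')" for c' s''
    using Suc cvars_step[OF that] by auto
  then show ?case
    unfolding wp.simps step_overlay[OF Suc.prems]
    by (auto simp: case_prod_unfold intro!: nn_integral_cong_AE AE_pmfI)
qed

primrec clear :: "nat \<Rightarrow> com" where
  "clear 0 = Skip"
| "clear (Suc j) = Seq (clear j) (Assign j NulE)"

lemma ensures_clear: "ensures (2 * j) (clear j) (\<lambda>s'. s' = overlay j (\<lambda>_. Nul) s) s"
proof (induction j)
  case 0
  have "s = overlay 0 (\<lambda>_. Nul) s" by auto
  then show ?case by (simp add: ensures_Skip)
next
  case (Suc j)
  have "(overlay j (\<lambda>_. Nul) s)(j := Nul) = overlay (Suc j) (\<lambda>_. Nul) s"
    by (auto simp: overlay_def)
  then have "ensures 1 (Assign j NulE) (\<lambda>s'. s' = overlay (Suc j) (\<lambda>_. Nul) s)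
      (overlay j (\<lambda>_. Nul) s)"
    by simp
  from ensures_Seq_eq[OF Suc this] show ?case by simp
qed

section \<open>Disjoint unions of models\<close>

abbreviation simple :: "potts \<Rightarrow> bool" where
  "simple M \<equiv> simple_graph (order M) (edges M)"

lemma simple_graph_subset: "simple_graph n E \<Longrightarrow> e \<in> E \<Longrightarrow> e \<subseteq> {..<n}"
  by (simp add: simple_graph_def)

lemma simple_graph_nonempty: "simple_graph n E \<Longrightarrow> e \<in> E \<Longrightarrow> e \<noteq> {}"
  by (auto simp: simple_graph_def)

lemma simple_graph_finite: "simple_graph n E \<Longrightarrow> finite E"
  by (rule finite_subset[of _ "Pow {..<n}"]) (auto dest: simple_graph_subset)

definition reversal :: "nat \<Rightarrow> nat \<Rightarrow> nat" where
  "reversal n i = n - Suc i"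

lemma reversal_less: "i < n \<Longrightarrow> reversal n i < n"
  by (simp add: reversal_def)

lemma reversal_reversal: "i < n \<Longrightarrow> reversal n (reversal n i) = i"
  by (simp add: reversal_def)

lemma reversal_add_ge: "i < m \<Longrightarrow> n \<le> reversal (m + n) i"
  by (simp add: reversal_def)

lemma reversal_add_less: "n \<le> v \<Longrightarrow> v < m + n \<Longrightarrow> reversal (m + n) v < m"
  by (simp add: reversal_def)

lemma reversal_image_image:
  assumes "e \<subseteq> {..<n}"
  shows "reversal n ` reversal n ` e = e"
proof -
  have "(\<lambda>i. reversal n (reversal n i)) ` e = (\<lambda>i. i) ` e"
    using assms by (intro image_cong) (auto simp: reversal_reversal)
  then show ?thesis by (simp add: image_image)
qed

lemma inj_on_reversal: "inj_on (reversal n) {..<n}"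
  by (metis inj_onI lessThan_iff reversal_reversal)

lemma mem_image_reversal_iff:
  assumes "E \<subseteq> Pow {..<n}" "e \<subseteq> {..<n}"
  shows "e \<in> (`) (reversal n) ` E \<longleftrightarrow> reversal n ` e \<in> E"
proof
  assume "e \<in> (`) (reversal n) ` E"
  then show "reversal n ` e \<in> E"
    using assms(1) by (auto simp: reversal_image_image)
next
  assume "reversal n ` e \<in> E"
  then show "e \<in> (`) (reversal n) ` E"
    using reversal_image_image[OF assms(2)] by (metis image_eqI)
qed

lemma card_incident_reversal_le:
  assumes "E \<subseteq> Pow {..<n}" "card {e \<in> E. reversal n v \<in> e} \<le> d"
  shows "card {e \<in> (`) (reversal n) ` E. v \<in> e} \<le> d"
proof -
  let ?incident = "{e \<in> E. reversal n v \<in> e}"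
  have "{e \<in> (`) (reversal n) ` E. v \<in> e} \<subseteq> (`) (reversal n) ` ?incident"
  proof
    fix e assume "e \<in> {e \<in> (`) (reversal n) ` E. v \<in> e}"
    then obtain e' i where e': "e' \<in> E" "e = reversal n ` e'" "i \<in> e'" "v = reversal n i"
      by blast
    then have "reversal n v = i"
      using assms(1) by (auto intro!: reversal_reversal)
    with e' show "e \<in> (`) (reversal n) ` ?incident"
      by auto
  qed
  moreover have "finite ?incident"
    using assms(1) by (auto intro: finite_subset[of _ "Pow {..<n}"])
  ultimately show ?thesis
    using assms(2) by (meson le_trans surj_card_le)
qed

text \<open>Vertices are numbered in reversed order, because consing onto an accumulator while walking through
  a list reverses it.\<close>

definition disjoint_union :: "potts \<Rightarrow> potts \<Rightarrow> potts" where
  "disjoint_union M N = \<lparr>spins = spins M, order = order M + order N,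
     edges = (`) (reversal (order M + order N)) ` edges M \<union> (`) (reversal (order N)) ` edges N,
     beta = (\<lambda>e. if e \<subseteq> {..<order N} then beta N (reversal (order N) ` e)
       else beta M (reversal (order M + order N) ` e)),
     field = (\<lambda>v. if v < order N then field N (reversal (order N) v)
       else field M (reversal (order M + order N) v))\<rparr>"

lemma disjoint_union_sel [simp]:
  "spins (disjoint_union M N) = spins M"
  "order (disjoint_union M N) = order M + order N"
  by (simp_all add: disjoint_union_def)

lemma edges_disjoint_union:
  "edges (disjoint_union M N)
    = (`) (reversal (order M + order N)) ` edges M \<union> (`) (reversal (order N)) ` edges N"
  by (simp add: disjoint_union_def)

lemma beta_disjoint_union:
  "beta (disjoint_union M N) e = (if e \<subseteq> {..<order N} then beta N (reversal (order N) ` e)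
    else beta M (reversal (order M + order N) ` e))"
  by (simp add: disjoint_union_def)

lemma field_disjoint_union:
  "field (disjoint_union M N) v = (if v < order N then field N (reversal (order N) v)
    else field M (reversal (order M + order N) v))"
  by (simp add: disjoint_union_def)

locale simple_models =
  fixes M N :: potts
  assumes simple_M: "simple M" and simple_N: "simple N"
begin

abbreviation (input) "m \<equiv> order M"
abbreviation (input) "n \<equiv> order N"

lemma edges_M_subset: "edges M \<subseteq> Pow {..<m + n}"
  using simple_graph_subset[OF simple_M] by fastforce

lemma edges_N_subset: "edges N \<subseteq> Pow {..<n}"
  using simple_graph_subset[OF simple_N] by blast

lemma reversal_edge_M: "e \<in> edges M \<Longrightarrow> reversal (m + n) ` e \<subseteq> {n..<m + n}"
  using simple_graph_subset[OF simple_M, of e] by (force simp: reversal_def)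

lemma reversal_edge_N: "e \<in> edges N \<Longrightarrow> reversal n ` e \<subseteq> {..<n}"
  using simple_graph_subset[OF simple_N, of e] by (force simp: reversal_def)

lemma beta_reversal_M:
  assumes e: "e \<in> edges M"
  shows "beta (disjoint_union M N) (reversal (m + n) ` e) = beta M e"
proof -
  have "e \<subseteq> {..<m + n}"
    using edges_M_subset e by auto
  moreover have "\<not> reversal (m + n) ` e \<subseteq> {..<n}"
    using reversal_edge_M[OF e] simple_graph_nonempty[OF simple_M e] by fastforce
  ultimately show ?thesis
    by (simp add: beta_disjoint_union reversal_image_image)
qed

lemma beta_reversal_N: "e \<in> edges N \<Longrightarrow> beta (disjoint_union M N) (reversal n ` e) = beta N e"
  using reversal_edge_N[of e] edges_N_subset by (auto simp: beta_disjoint_union reversal_image_image)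

lemma simple_disjoint_union: "simple (disjoint_union M N)"
proof -
  have card: "card (reversal k ` e) = card e" if "e \<subseteq> {..<k}" for k e
    using card_image[OF inj_on_subset[OF inj_on_reversal that]] .
  have "reversal (m + n) ` e \<subseteq> {..<m + n} \<and> card (reversal (m + n) ` e) = 2" if "e \<in> edges M" for e
  proof
    show "reversal (m + n) ` e \<subseteq> {..<m + n}"
      using reversal_edge_M[OF that] by auto
    show "card (reversal (m + n) ` e) = 2"
      using card[of e "m + n"] edges_M_subset that simple_M by (auto simp: simple_graph_def)
  qed
  moreover have "reversal n ` e \<subseteq> {..<m + n} \<and> card (reversal n ` e) = 2" if "e \<in> edges N" for e
  proof
    show "reversal n ` e \<subseteq> {..<m + n}"
      using reversal_edge_N[OF that] by auto
    show "card (reversal n ` e) = 2"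
      using card[of e n] edges_N_subset that simple_N by (auto simp: simple_graph_def)
  qed
  ultimately show ?thesis
    unfolding simple_graph_def edges_disjoint_union disjoint_union_sel by blast
qed

lemma edges_disjoint_union_iff:
  assumes "u < m + n" "v < m + n"
  shows "{u, v} \<in> edges (disjoint_union M N) \<longleftrightarrow>
    (if u < n \<and> v < n then {reversal n u, reversal n v} \<in> edges N
     else n \<le> u \<and> n \<le> v \<and> {reversal (m + n) u, reversal (m + n) v} \<in> edges M)"
proof -
  have "{u, v} \<in> (`) (reversal (m + n)) ` edges M
      \<longleftrightarrow> {reversal (m + n) u, reversal (m + n) v} \<in> edges M"
    using mem_image_reversal_iff[OF edges_M_subset, of "{u, v}"] assms by simp
  moreover have "{u, v} \<subseteq> {n..<m + n}" if "{u, v} \<in> (`) (reversal (m + n)) ` edges M"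
    using that reversal_edge_M by (metis imageE)
  moreover have "{u, v} \<in> (`) (reversal n) ` edges N \<longleftrightarrow> {reversal n u, reversal n v} \<in> edges N"
    if "u < n" "v < n"
    using mem_image_reversal_iff[OF edges_N_subset, of "{u, v}"] that by simp
  moreover have "{u, v} \<subseteq> {..<n}" if "{u, v} \<in> (`) (reversal n) ` edges N"
    using that reversal_edge_N by (metis imageE)
  ultimately show ?thesis unfolding edges_disjoint_union by auto
qed

lemma max_degree_le_disjoint_union:
  assumes "max_degree_le m (edges M) d" "max_degree_le n (edges N) d"
  shows "max_degree_le (m + n) (edges (disjoint_union M N)) d"
  unfolding max_degree_le_def
proof (intro allI impI)
  fix v assume v: "v < m + n"
  show "card {e \<in> edges (disjoint_union M N). v \<in> e} \<le> d"
  proof (cases "v < n")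
    case True
    then have "{e \<in> edges (disjoint_union M N). v \<in> e} = {e \<in> (`) (reversal n) ` edges N. v \<in> e}"
      unfolding edges_disjoint_union by (auto dest!: reversal_edge_M)
    moreover have "card {e \<in> edges N. reversal n v \<in> e} \<le> d"
      using assms(2) True by (simp add: max_degree_le_def reversal_less)
    ultimately show ?thesis
      using card_incident_reversal_le[OF edges_N_subset] by simp
  next
    case False
    then have "{e \<in> edges (disjoint_union M N). v \<in> e}
        = {e \<in> (`) (reversal (m + n)) ` edges M. v \<in> e}"
      unfolding edges_disjoint_union by (auto dest!: reversal_edge_N)
    moreover have "card {e \<in> edges M. reversal (m + n) v \<in> e} \<le> d"
      using assms(1) False v by (simp add: max_degree_le_def reversal_add_less)
    ultimately show ?thesis
      using card_incident_reversal_le[OF edges_M_subset] by simp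
  qed
qed

lemma sum_edges_disjoint_union:
  fixes f :: "nat set \<Rightarrow> real"
  shows "(\<Sum>e\<in>edges (disjoint_union M N). f e)
    = (\<Sum>e\<in>edges M. f (reversal (m + n) ` e)) + (\<Sum>e\<in>edges N. f (reversal n ` e))"
proof -
  have "inj_on ((`) (reversal (m + n))) (edges M)" "inj_on ((`) (reversal n)) (edges N)"
    using inj_on_image_Pow[OF inj_on_reversal] edges_M_subset edges_N_subset
    by (meson inj_on_subset)+
  moreover have "(`) (reversal (m + n)) ` edges M \<inter> (`) (reversal n) ` edges N = {}"
    using reversal_edge_M reversal_edge_N simple_graph_nonempty[OF simple_M] by fastforce
  ultimately show ?thesis
    using simple_graph_finite[OF simple_M] simple_graph_finite[OF simple_N]
    by (simp add: edges_disjoint_union sum.union_disjoint sum.reindex)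
qed

lemma sum_vertices_disjoint_union:
  fixes f :: "nat \<Rightarrow> real"
  shows "(\<Sum>v<m + n. f v) = (\<Sum>i<m. f (reversal (m + n) i)) + (\<Sum>j<n. f (reversal n j))"
proof -
  have "(\<Sum>v<m + n. f v) = (\<Sum>v\<in>{n..<m + n}. f v) + (\<Sum>v<n. f v)"
    using sum.atLeastLessThan_concat[of 0 n "m + n" f] by (simp add: atLeast0LessThan add.commute)
  also have "(\<Sum>v\<in>{n..<m + n}. f v) = (\<Sum>i<m. f (reversal (m + n) i))"
    by (rule sum.reindex_bij_witness[of _ "reversal (m + n)" "reversal (m + n)"])
      (auto simp: reversal_def)
  also have "(\<Sum>v<n. f v) = (\<Sum>j<n. f (reversal n j))"
    unfolding reversal_def by (rule sum.nat_diff_reindex[symmetric])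
  finally show ?thesis .
qed

definition glue :: "(nat \<Rightarrow> nat) \<Rightarrow> (nat \<Rightarrow> nat) \<Rightarrow> nat \<Rightarrow> nat" where
  "glue \<sigma> \<tau> = restrict (\<lambda>v. if v < n then \<tau> (reversal n v) else \<sigma> (reversal (m + n) v)) {..<m + n}"

lemma glue_reversal_M: "i < m \<Longrightarrow> glue \<sigma> \<tau> (reversal (m + n) i) = \<sigma> i"
  using reversal_add_ge[of i m n] by (simp add: glue_def reversal_less reversal_reversal)

lemma glue_reversal_N: "j < n \<Longrightarrow> glue \<sigma> \<tau> (reversal n j) = \<tau> j"
  using reversal_less[of j n] by (simp add: glue_def reversal_reversal)

lemma weight_glue: "weight (disjoint_union M N) (glue \<sigma> \<tau>) = weight M \<sigma> * weight N \<tau>"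
proof -
  have glue_M: "glue \<sigma> \<tau> (reversal (m + n) u) = \<sigma> u" if "e \<in> edges M" "u \<in> e" for e u
    using simple_graph_subset[OF simple_M that(1)] that(2) by (auto simp: glue_reversal_M)
  have glue_N: "glue \<sigma> \<tau> (reversal n u) = \<tau> u" if "e \<in> edges N" "u \<in> e" for e u
    using simple_graph_subset[OF simple_N that(1)] that(2) by (auto simp: glue_reversal_N)
  have field_M: "field (disjoint_union M N) (reversal (m + n) i) = field M i" if "i < m" for i
    using that reversal_add_ge[OF that, of n] by (simp add: field_disjoint_union reversal_reversal)
  have field_N: "field (disjoint_union M N) (reversal n j) = field N j" if "j < n" for j
    using that by (simp add: field_disjoint_union reversal_less reversal_reversal)
  show ?thesis
    unfolding weight_def disjoint_union_sel sum_edges_disjoint_union sum_vertices_disjoint_union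
    by (simp add: glue_M glue_N beta_reversal_M beta_reversal_N field_M field_N
        glue_reversal_M glue_reversal_N flip: exp_add)
qed

lemma glue_in_configurations:
  assumes "spins M = spins N" "\<sigma> \<in> configurations M" "\<tau> \<in> configurations N"
  shows "glue \<sigma> \<tau> \<in> configurations (disjoint_union M N)"
proof -
  have "\<sigma> i \<in> {1..spins M}" if "i < m" for i
    using PiE_mem[OF assms(2)[unfolded configurations_def]] that by simp
  moreover have "\<tau> j \<in> {1..spins M}" if "j < n" for j
    using PiE_mem[OF assms(3)[unfolded configurations_def]] assms(1) that by simp
  ultimately show ?thesis
    unfolding configurations_def glue_def
    by (simp add: reversal_less reversal_add_less restrict_PiE_iff del: atLeastAtMost_iff)
qed

definition unglue :: "(nat \<Rightarrow> nat) \<Rightarrow> (nat \<Rightarrow> nat) \<times> (nat \<Rightarrow> nat)" where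
  "unglue \<upsilon> = (restrict (\<lambda>i. \<upsilon> (reversal (m + n) i)) {..<m}, restrict (\<lambda>j. \<upsilon> (reversal n j)) {..<n})"

lemma unglue_in_configurations:
  assumes "spins M = spins N" "\<upsilon> \<in> configurations (disjoint_union M N)"
  shows "unglue \<upsilon> \<in> configurations M \<times> configurations N"
proof -
  have "\<upsilon> v \<in> {1..spins M}" if "v < m + n" for v
    using PiE_mem[OF assms(2)[unfolded configurations_def]] that by simp
  moreover have "reversal (m + n) i < m + n" if "i < m" for i
    using that by (intro reversal_less) simp
  moreover have "reversal n j < m + n" if "j < n" for j
    using reversal_less[OF that] by simp
  ultimately show ?thesis
    using assms(1) unfolding unglue_def configurations_def
    by (simp add: restrict_PiE_iff del: atLeastAtMost_iff)
qed

lemma unglue_glue: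
  assumes "\<sigma> \<in> configurations M" "\<tau> \<in> configurations N"
  shows "unglue (glue \<sigma> \<tau>) = (\<sigma>, \<tau>)"
proof -
  have "restrict (\<lambda>i. glue \<sigma> \<tau> (reversal (m + n) i)) {..<m} = restrict \<sigma> {..<m}"
    "restrict (\<lambda>j. glue \<sigma> \<tau> (reversal n j)) {..<n} = restrict \<tau> {..<n}"
    by (intro restrict_ext; simp add: glue_reversal_M glue_reversal_N)+
  then show ?thesis
    using assms by (simp add: unglue_def configurations_def PiE_def extensional_restrict)
qed

lemma glue_unglue:
  assumes "\<upsilon> \<in> configurations (disjoint_union M N)"
  shows "case_prod glue (unglue \<upsilon>) = \<upsilon>"
proof -
  have "glue (fst (unglue \<upsilon>)) (snd (unglue \<upsilon>)) = restrict \<upsilon> {..<m + n}"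
    unfolding glue_def unglue_def
    by (intro restrict_ext) (simp add: reversal_less reversal_add_less reversal_reversal)
  then show ?thesis
    using assms by (simp add: case_prod_unfold configurations_def PiE_def extensional_restrict)
qed

lemma bij_betw_glue:
  assumes "spins M = spins N"
  shows "bij_betw (case_prod glue) (configurations M \<times> configurations N)
    (configurations (disjoint_union M N))"
  using assms
  by (intro bij_betw_byWitness[where f' = unglue] ballI image_subsetI)
    (auto simp: glue_unglue unglue_glue glue_in_configurations unglue_in_configurations)

lemma partition_function_disjoint_union:
  assumes "spins M = spins N"
  shows "partition_function (disjoint_union M N) = partition_function M * partition_function N"
proof -
  have "partition_function (disjoint_union M N)
      = (\<Sum>(\<sigma>, \<tau>)\<in>configurations M \<times> configurations N. weight (disjoint_union M N) (glue \<sigma> \<tau>))"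
    unfolding partition_function_def sum.reindex_bij_betw[OF bij_betw_glue[OF assms], symmetric]
    by (simp add: case_prod_unfold)
  then show ?thesis
    by (simp add: weight_glue partition_function_def sum_product sum.cartesian_product)
qed

end

definition uniform_models :: "nat \<Rightarrow> nat \<Rightarrow> real \<Rightarrow> real \<Rightarrow> nat \<Rightarrow> potts set" where
  "uniform_models q d b h n = {M \<in> bounded_models q n d h. \<forall>e\<in>edges M. beta M e = b}"

lemma
  assumes "M \<in> uniform_models q d b h n"
  shows uniform_models_spins: "spins M = q"
    and uniform_models_order: "order M = n"
    and uniform_models_simple: "simple M"
    and uniform_models_max_degree: "max_degree_le n (edges M) d"
    and uniform_models_field: "v < n \<Longrightarrow> i \<in> {1..q} \<Longrightarrow> \<bar>field M v i\<bar> \<le> h"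
    and uniform_models_beta: "e \<in> edges M \<Longrightarrow> beta M e = b"
  using assms by (auto simp: uniform_models_def bounded_models_def)

lemma disjoint_union_uniform_models:
  assumes "M \<in> uniform_models q d b h m" "N \<in> uniform_models q d b h n"
  shows "disjoint_union M N \<in> uniform_models q d b h (m + n)"
proof -
  interpret simple_models M N
    using assms by unfold_locales (auto intro: uniform_models_simple)
  note spins = assms[THEN uniform_models_spins] and order = assms[THEN uniform_models_order]
  have "beta (disjoint_union M N) e = b" if "e \<in> edges (disjoint_union M N)" for e
    using that assms[THEN uniform_models_beta]
    by (auto simp: edges_disjoint_union beta_reversal_M beta_reversal_N)
  moreover have "\<bar>field (disjoint_union M N) v i\<bar> \<le> h" if "v < m + n" "i \<in> {1..q}" for v i
    using that assms[THEN uniform_models_field]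
    by (auto simp: field_disjoint_union order reversal_less reversal_add_less)
  moreover have "max_degree_le (m + n) (edges (disjoint_union M N)) d"
    using max_degree_le_disjoint_union assms[THEN uniform_models_max_degree] by (simp add: order)
  ultimately show ?thesis
    using simple_disjoint_union by (simp add: uniform_models_def bounded_models_def spins order)
qed

primrec copies :: "nat \<Rightarrow> potts \<Rightarrow> potts" where
  "copies 0 M = M\<lparr>order := 0, edges := {}\<rparr>"
| "copies (Suc k) M = disjoint_union M (copies k M)"

lemma spins_copies [simp]: "spins (copies k M) = spins M"
  by (induction k) simp_all

lemma order_copies [simp]: "order (copies k M) = k * order M"
  by (induction k) simp_all

lemma simple_copies: "simple M \<Longrightarrow> simple (copies k M)"
proof (induction k)
  case 0
  show ?case by (simp add: simple_graph_def)
next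
  case (Suc k)
  then interpret simple_models M "copies k M"
    by unfold_locales
  show ?case using simple_disjoint_union by simp
qed

lemma partition_function_copies:
  assumes "simple M"
  shows "partition_function (copies k M) = partition_function M ^ k"
proof (induction k)
  case 0
  show ?case by (simp add: partition_function_def configurations_def weight_def)
next
  case (Suc k)
  interpret simple_models M "copies k M"
    using assms simple_copies by unfold_locales
  show ?case using Suc by (simp add: partition_function_disjoint_union)
qed

lemma copies_uniform_models:
  assumes "M \<in> uniform_models q d b h n"
  shows "copies k M \<in> uniform_models q d b h (k * n)"
proof (induction k)
  case 0
  show ?case
    using uniform_models_spins[OF assms]
    by (simp add: uniform_models_def bounded_models_def simple_graph_def max_degree_le_def)
next
  case (Suc k)
  with assms disjoint_union_uniform_models show ?case by simp
qed

section \<open>Bounds on the partition function\<close>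

lemma card_edges_le_order_squared:
  assumes "simple_graph n E"
  shows "card E \<le> n\<^sup>2"
proof -
  have "E \<subseteq> {e. e \<subseteq> {..<n} \<and> card e = 2}"
    using assms by (auto simp: simple_graph_def)
  then have "card E \<le> card {e. e \<subseteq> {..<n} \<and> card e = 2}"
    by (intro card_mono) (auto intro: finite_subset[of _ "Pow {..<n}"])
  also have "\<dots> = n choose 2"
    by (simp add: n_subsets)
  also have "\<dots> \<le> n\<^sup>2"
    by (cases "2 \<le> n") (auto intro: binomial_le_pow simp: binomial_eq_0)
  finally show ?thesis .
qed

lemma abs_ln_weight_le:
  assumes "M \<in> uniform_models q d b h n" "h \<ge> 0" "\<sigma> \<in> configurations M"
  shows "\<bar>ln (weight M \<sigma>)\<bar> \<le> (\<bar>b\<bar> + h) * (real n)\<^sup>2"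
proof -
  note order = uniform_models_order[OF assms(1)]
  let ?interaction = "\<Sum>e\<in>edges M. beta M e * of_bool (\<forall>u\<in>e. \<forall>v\<in>e. \<sigma> u = \<sigma> v)"
    and ?external = "\<Sum>v<order M. field M v (\<sigma> v)"
  have "\<bar>?interaction\<bar> \<le> (\<Sum>e\<in>edges M. \<bar>b\<bar>)"
    using uniform_models_beta[OF assms(1)]
    by (intro order_trans[OF sum_abs] sum_mono) (auto simp: abs_mult)
  also have "\<dots> \<le> (real n)\<^sup>2 * \<bar>b\<bar>"
    using card_edges_le_order_squared[OF uniform_models_simple[OF assms(1)]]
    by (simp add: order mult_right_mono flip: of_nat_power)
  finally have "\<bar>?interaction\<bar> \<le> (real n)\<^sup>2 * \<bar>b\<bar>" .
  moreover have "\<bar>?external\<bar> \<le> (\<Sum>v<n. h)"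
    unfolding order
  proof (intro order_trans[OF sum_abs] sum_mono)
    fix v assume "v \<in> {..<n}"
    then show "\<bar>field M v (\<sigma> v)\<bar> \<le> h"
      using PiE_mem[OF assms(3)[unfolded configurations_def]] uniform_models_spins[OF assms(1)]
      by (intro uniform_models_field[OF assms(1)]) (auto simp: order)
  qed
  moreover have "\<dots> \<le> (real n)\<^sup>2 * h"
    using assms(2) by (simp add: mult_right_mono power2_eq_square flip: of_nat_mult)
  ultimately have "\<bar>?interaction + ?external\<bar> \<le> (\<bar>b\<bar> + h) * (real n)\<^sup>2"
    by (simp add: algebra_simps)
  then show ?thesis by (simp add: weight_def)
qed

lemma partition_function_pos:
  assumes "M \<in> uniform_models q d b h n" "q \<ge> 1"
  shows "partition_function M > 0"
  unfolding partition_function_def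
proof (rule sum_pos)
  have configurations: "configurations M = {..<n} \<rightarrow>\<^sub>E {1..q}"
    using uniform_models_spins[OF assms(1)] uniform_models_order[OF assms(1)]
    by (simp add: configurations_def)
  show "finite (configurations M)" "configurations M \<noteq> {}"
    unfolding configurations using assms(2) by (auto simp: PiE_eq_empty_iff intro: finite_PiE)
qed (simp add: weight_def)

lemma abs_ln_partition_function_le:
  assumes "M \<in> uniform_models q d b h n" "q \<ge> 1" "h \<ge> 0"
  shows "\<bar>ln (partition_function M)\<bar> \<le> (ln q + \<bar>b\<bar> + h) * (real n)\<^sup>2"
proof -
  let ?B = "(\<bar>b\<bar> + h) * (real n)\<^sup>2"
  note pos = partition_function_pos[OF assms(1,2)]
  have card: "card (configurations M) = q ^ n"
    using uniform_models_spins[OF assms(1)] uniform_models_order[OF assms(1)]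
    by (simp add: configurations_def card_PiE)
  have ln_scale: "ln (real q ^ n * exp x) = real n * ln q + x" for x
    using assms(2) by (simp add: ln_mult ln_realpow)
  have weight: "exp (- ?B) \<le> weight M \<sigma>" "weight M \<sigma> \<le> exp ?B" if "\<sigma> \<in> configurations M" for \<sigma>
    using abs_ln_weight_le[OF assms(1,3) that] by (auto simp: weight_def abs_le_iff)
  have "real q ^ n * exp (- ?B) \<le> partition_function M"
    unfolding partition_function_def
    using sum_bounded_below[of "configurations M" "exp (- ?B)" "weight M"] weight by (simp add: card)
  then have "real n * ln q - ?B \<le> ln (partition_function M)"
    using ln_mono[of "real q ^ n * exp (- ?B)" "partition_function M"] assms(2) pos
    by (simp add: ln_scale)
  moreover have "partition_function M \<le> real q ^ n * exp ?B"
    unfolding partition_function_def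
    using sum_bounded_above[of "configurations M" "weight M" "exp ?B"] weight by (simp add: card)
  then have "ln (partition_function M) \<le> real n * ln q + ?B"
    using ln_mono[of "partition_function M" "real q ^ n * exp ?B"] pos by (simp add: ln_scale)
  moreover have "0 \<le> real n * ln q" "real n * ln q \<le> (real n)\<^sup>2 * ln q"
    using assms(2) by (auto intro!: mult_right_mono simp: power2_eq_square simp flip: of_nat_mult)
  ultimately show ?thesis by (simp add: algebra_simps)
qed

section \<open>Encodings of disjoint unions\<close>

definition encode_fields :: "potts \<Rightarrow> nat \<Rightarrow> val" where
  "encode_fields M v = encode_list (map (\<lambda>i. Atom (field M v i)) [1..<spins M + 1])"

definition adjacency_row :: "potts \<Rightarrow> nat \<Rightarrow> val list" where
  "adjacency_row M v = map (\<lambda>u. if {u, v} \<in> edges M then Atom (beta M {u, v}) else Nul) [0..<order M]"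

definition encode_padded_vertex :: "nat \<Rightarrow> potts \<Rightarrow> nat \<Rightarrow> nat \<Rightarrow> val" where
  "encode_padded_vertex i M j v = Pair (encode_fields M v)
     (encode_list (rev (replicate i Nul @ adjacency_row M v @ replicate j Nul)))"

lemma encode_vertex_eq:
  "encode_vertex M v = Pair (encode_fields M v) (encode_list (adjacency_row M v))"
  by (simp add: encode_vertex_def encode_fields_def adjacency_row_def del: upt_Suc)

lemma length_adjacency_row [simp]: "length (adjacency_row M v) = order M"
  by (simp add: adjacency_row_def)

context simple_models
begin

lemma adjacency_row_disjoint_union_N:
  assumes "v < n"
  shows "adjacency_row (disjoint_union M N) v
    = rev (replicate m Nul @ adjacency_row N (reversal n v))"
proof (rule nth_equalityI)
  fix u assume "u < length (adjacency_row (disjoint_union M N) v)"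
  then show "adjacency_row (disjoint_union M N) v ! u
      = rev (replicate m Nul @ adjacency_row N (reversal n v)) ! u"
    using assms
    by (auto simp: adjacency_row_def rev_nth nth_append edges_disjoint_union_iff beta_disjoint_union
        reversal_def)
qed simp

lemma adjacency_row_disjoint_union_M:
  assumes "n \<le> v" "v < m + n"
  shows "adjacency_row (disjoint_union M N) v
    = rev (adjacency_row M (reversal (m + n) v) @ replicate n Nul)"
proof (rule nth_equalityI)
  fix u assume "u < length (adjacency_row (disjoint_union M N) v)"
  then show "adjacency_row (disjoint_union M N) v ! u
      = rev (adjacency_row M (reversal (m + n) v) @ replicate n Nul) ! u"
    using assms
    by (auto simp: adjacency_row_def rev_nth nth_append edges_disjoint_union_iff beta_disjoint_union
        reversal_def)
qed simp

lemma encode_disjoint_union: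
  assumes "spins M = spins N"
  shows "encode (disjoint_union M N) = encode_list (rev
    (map (encode_padded_vertex 0 M n) [0..<m] @ map (encode_padded_vertex m N 0) [0..<n]))"
proof -
  have "map (encode_vertex (disjoint_union M N)) [0..<m + n]
    = rev (map (encode_padded_vertex 0 M n) [0..<m] @ map (encode_padded_vertex m N 0) [0..<n])"
  proof (rule nth_equalityI)
    fix v assume "v < length (map (encode_vertex (disjoint_union M N)) [0..<m + n])"
    then have v: "v < m + n" by simp
    have "encode_fields (disjoint_union M N) v
        = (if v < n then encode_fields N (reversal n v) else encode_fields M (reversal (m + n) v))"
      using assms by (simp add: encode_fields_def field_disjoint_union)
    then show "map (encode_vertex (disjoint_union M N)) [0..<m + n] ! v
      = rev (map (encode_padded_vertex 0 M n) [0..<m] @ map (encode_padded_vertex m N 0) [0..<n]) ! v"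
      using v adjacency_row_disjoint_union_M[of v] adjacency_row_disjoint_union_N[of v]
      by (auto simp: encode_vertex_eq encode_padded_vertex_def rev_nth nth_append reversal_def)
  qed simp
  then show ?thesis by (simp add: encode_def)
qed

end

section \<open>A biased random walk\<close>

definition potential :: "real \<Rightarrow> real" where
  "potential x = (4/3) powr x + (4/3) powr (- x)"

lemma potential_add_1: "potential (x + 1) = 4/3 * (4/3) powr x + 3/4 * (4/3) powr (- x)"
  by (simp add: potential_def powr_add powr_diff powr_minus field_simps)

lemma potential_diff_1: "potential (x - 1) = 3/4 * (4/3) powr x + 4/3 * (4/3) powr (- x)"
  by (simp add: potential_def powr_add powr_diff powr_minus field_simps)

lemma potential_minus: "potential (- x) = potential x"
  by (simp add: potential_def)

lemma potential_nonneg: "potential x \<ge> 0"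
  by (simp add: potential_def)

lemma potential_ge: "potential x \<ge> (4/3) powr \<bar>x\<bar>"
  by (cases "x \<ge> 0") (auto simp: potential_def)

lemma potential_le: "potential x \<le> 2 * (4/3) powr \<bar>x\<bar>"
proof -
  have "(4/3) powr x \<le> (4/3 :: real) powr \<bar>x\<bar>" "(4/3) powr (- x) \<le> (4/3 :: real) powr \<bar>x\<bar>"
    by (intro powr_mono; simp)+
  then show ?thesis unfolding potential_def by linarith
qed

text \<open>A step in the right direction with probability at least 5/8 multiplies the dominant term by at
  most \<open>5/8 * 3/4 + 3/8 * 4/3 = 31/32\<close> on average.\<close>

lemma potential_drift_right:
  assumes "x \<ge> 1" "u \<le> 3/8"
  shows "u * potential (x + 1) + (1 - u) * potential (x - 1) \<le> 31/32 * potential x + 1"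
proof -
  define P Q where "P = (4/3 :: real) powr x" and "Q = (4/3 :: real) powr (- x)"
  note potential = potential_def[of x, folded P_def Q_def] potential_add_1[of x, folded P_def Q_def]
    potential_diff_1[of x, folded P_def Q_def]
  have "(4/3) powr 1 \<le> P"
    unfolding P_def using assms(1) by (intro powr_mono) auto
  moreover have "Q \<le> (4/3) powr (- 1)"
    unfolding Q_def using assms(1) by (intro powr_mono) auto
  ultimately have PQ: "P \<ge> 4/3" "Q \<le> 3/4"
    by (auto simp: powr_minus)
  have "u * potential (x + 1) + (1 - u) * potential (x - 1)
      = 31/32 * P + 107/96 * Q - 7/12 * ((3/8 - u) * (P - Q))"
    unfolding potential by (simp add: field_simps)
  moreover have "0 \<le> (3/8 - u) * (P - Q)"
    using assms(2) PQ by simp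
  ultimately show ?thesis
    unfolding potential using PQ by argo
qed

lemma potential_drift_center:
  assumes "\<bar>x\<bar> \<le> 1" "0 \<le> u" "u \<le> 1"
  shows "u * potential (x + 1) + (1 - u) * potential (x - 1) \<le> 31/32 * potential x + 1"
proof -
  define P Q where "P = (4/3 :: real) powr x" and "Q = (4/3 :: real) powr (- x)"
  note potential = potential_def[of x, folded P_def Q_def] potential_add_1[of x, folded P_def Q_def]
    potential_diff_1[of x, folded P_def Q_def]
  have PQ: "0 \<le> P" "0 \<le> Q" by (simp_all add: P_def Q_def)
  have "P \<le> (4/3) powr 1" "Q \<le> (4/3) powr 1"
    unfolding P_def Q_def using assms(1) by (intro powr_mono; simp)+
  then have le: "P \<le> 4/3" "Q \<le> 4/3" by auto
  have "u * potential (x + 1) + (1 - u) * potential (x - 1)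
      \<le> u * (4/3 * (P + Q)) + (1 - u) * (4/3 * (P + Q))"
    unfolding potential using assms(2,3) PQ by (intro add_mono mult_left_mono) auto
  also have "\<dots> = 4/3 * (P + Q)" by (simp add: field_simps)
  also have "\<dots> \<le> 31/32 * (P + Q) + 1" using le by argo
  finally show ?thesis unfolding potential .
qed

lemma potential_drift:
  assumes "0 \<le> u" "u \<le> 1" "x \<ge> 1 \<Longrightarrow> u \<le> 3/8" "x \<le> -1 \<Longrightarrow> u \<ge> 5/8"
  shows "u * potential (x + 1) + (1 - u) * potential (x - 1) \<le> 31/32 * potential x + 1"
proof -
  consider "x \<ge> 1" | "x \<le> -1" | "\<bar>x\<bar> \<le> 1" by linarith
  then show ?thesis
  proof cases
    case 1
    with assms(3) show ?thesis by (intro potential_drift_right)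
  next
    case 2
    have "potential (- x + 1) = potential (x - 1)" "potential (- x - 1) = potential (x + 1)"
      using potential_minus[of "x - 1"] potential_minus[of "x + 1"] by simp_all
    with 2 assms(4) potential_drift_right[of "- x" "1 - u"] show ?thesis
      by (simp add: potential_minus)
  next
    case 3
    with assms(1,2) show ?thesis by (intro potential_drift_center)
  qed
qed

lemma potential_decay:
  assumes "10 * \<bar>x\<bar> \<le> real k"
  shows "(31/32) ^ k * potential x \<le> 2"
proof -
  have "(31/32 :: real) ^ k = (31/32) powr real k" by (simp add: powr_realpow)
  also have "\<dots> \<le> (31/32) powr (10 * \<bar>x\<bar>)" using assms by (intro powr_mono') auto
  also have "\<dots> = ((31/32) powr 10) powr \<bar>x\<bar>" unfolding powr_powr ..
  also have "\<dots> \<le> (3/4) powr \<bar>x\<bar>"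
    by (intro powr_mono2) (auto simp: powr_numeral power_divide)
  finally have "(31/32) ^ k * potential x \<le> (3/4) powr \<bar>x\<bar> * (2 * (4/3) powr \<bar>x\<bar>)"
    using potential_le[of x] potential_nonneg[of x] by (intro mult_mono) auto
  also have "\<dots> = 2 * (3/4 * (4/3)) powr \<bar>x\<bar>" by (subst powr_mult) auto
  finally show ?thesis by simp
qed

text \<open>Bounds the probability that a walk at \<open>x\<close> is at distance at least 20 from 0 after \<open>k\<close> further
  steps: iterating the drift bounds the expected potential by the second factor, and the potential
  is at least \<open>(4/3)^20\<close> there.\<close>

definition failure_bound :: "nat \<Rightarrow> real \<Rightarrow> real" where
  "failure_bound k x = (3/4) ^ 20 * ((31/32) ^ k * potential x + 32 * (1 - (31/32) ^ k))"

lemma failure_bound_nonneg: "failure_bound k x \<ge> 0"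
  by (simp add: failure_bound_def potential_nonneg power_le_one)

lemma failure_bound_0_ge:
  assumes "\<bar>x\<bar> \<ge> 20"
  shows "failure_bound 0 x \<ge> 1"
proof -
  have "(1 :: real) = (3/4) ^ 20 * (4/3) powr 20"
    by (simp add: powr_numeral power_divide)
  also have "\<dots> \<le> (3/4) ^ 20 * (4/3) powr \<bar>x\<bar>"
    using assms by (intro mult_left_mono powr_mono) auto
  also have "\<dots> \<le> (3/4) ^ 20 * potential x"
    by (intro mult_left_mono potential_ge) simp
  finally show ?thesis by (simp add: failure_bound_def)
qed

lemma failure_bound_Suc_ge:
  assumes "0 \<le> u" "u \<le> 1" "x \<ge> 1 \<Longrightarrow> u \<le> 3/8" "x \<le> -1 \<Longrightarrow> u \<ge> 5/8"
  shows "u * failure_bound k (x + 1) + (1 - u) * failure_bound k (x - 1) \<le> failure_bound (Suc k) x"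
proof -
  have "(3/4) ^ 20 * ((31/32) ^ k * (u * potential (x + 1) + (1 - u) * potential (x - 1)))
      \<le> (3/4) ^ 20 * ((31/32) ^ k * (31/32 * potential x + 1))"
    using potential_drift[OF assms] by (intro mult_left_mono) auto
  then show ?thesis by (simp add: failure_bound_def algebra_simps)
qed

lemma failure_bound_le:
  assumes "10 * \<bar>x\<bar> \<le> real k"
  shows "failure_bound k x \<le> 1/4"
proof -
  have "32 * (1 - (31/32) ^ k) \<le> (32 :: real)" by simp
  with potential_decay[OF assms]
  have "failure_bound k x \<le> (3/4) ^ 20 * (2 + 32)"
    unfolding failure_bound_def by (intro mult_left_mono add_mono) auto
  also have "\<dots> \<le> 1/4" by (simp add: power_divide)
  finally show ?thesis .
qed

section \<open>Answers of a decision procedure\<close>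

definition answers :: "com \<Rightarrow> val \<Rightarrow> nat \<Rightarrow> bool \<Rightarrow> bool \<Rightarrow> bool" where
  "answers p inp t low high \<longleftrightarrow> halts_within p inp t
     \<and> (low \<longrightarrow> measure_pmf.prob (output_dist p inp t) {Nul} \<ge> 5/8)
     \<and> (high \<longrightarrow> measure_pmf.prob (output_dist p inp t) (- {Nul}) \<ge> 5/8)"

definition decides_within :: "(nat \<Rightarrow> potts set) \<Rightarrow> (nat \<Rightarrow> real) \<Rightarrow> com \<Rightarrow> (nat \<Rightarrow> real) \<Rightarrow> bool" where
  "decides_within \<M> r p T \<longleftrightarrow>
     (\<forall>n\<ge>1. r n > 1 \<longrightarrow> (\<forall>M\<in>\<M> n. \<forall>guess. \<exists>t. real t \<le> T n
        \<and> answers p (Pair (Atom (r n)) (Pair (Atom guess) (encode M))) t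
            (partition_function M \<le> guess / r n) (r n * guess \<le> partition_function M)))"

lemma poly_time_decision_iff_decides_within:
  "poly_time_decision \<M> r p \<longleftrightarrow> (\<exists>C k. decides_within \<M> r p (\<lambda>n. C * real n ^ k))"
  by (simp add: poly_time_decision_def decides_within_def answers_def Let_def)

lemma answers_mono:
  "answers p inp t low high \<Longrightarrow> (low' \<Longrightarrow> low) \<Longrightarrow> (high' \<Longrightarrow> high) \<Longrightarrow> answers p inp t low' high'"
  by (auto simp: answers_def)

lemma nn_integral_if_pmf:
  fixes a b :: real
  assumes "a \<ge> 0" "b \<ge> 0"
  shows "(\<integral>\<^sup>+ v. ennreal (if v \<in> A then a else b) \<partial>measure_pmf D)
    = ennreal (measure_pmf.prob D A * a + measure_pmf.prob D (- A) * b)"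
proof -
  have "(\<integral>\<^sup>+ v. ennreal (if v \<in> A then a else b) \<partial>measure_pmf D)
      = (\<integral>\<^sup>+ v. ennreal a * indicator A v + ennreal b * indicator (- A) v \<partial>measure_pmf D)"
    by (intro nn_integral_cong) (auto simp: indicator_def)
  also have "\<dots> = ennreal a * emeasure D A + ennreal b * emeasure D (- A)"
    by (simp add: nn_integral_add nn_integral_cmult)
  also have "\<dots> = ennreal (a * measure_pmf.prob D A + b * measure_pmf.prob D (- A))"
    using assms by (simp add: measure_pmf.emeasure_eq_measure ennreal_mult ennreal_plus)
  finally show ?thesis by (simp add: mult.commute)
qed

lemma wp_failure_bound_le_if_answers:
  assumes "answers p inp t (x \<ge> 1) (x \<le> -1)"
  shows "wp t p (\<lambda>s. ennreal (failure_bound k (if s 0 \<noteq> Nul then x + 1 else x - 1))) (initial inp)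
    \<le> ennreal (failure_bound (Suc k) x)"
proof -
  let ?D = "output_dist p inp t"
  have "wp t p (\<lambda>s. ennreal (failure_bound k (if s 0 \<noteq> Nul then x + 1 else x - 1))) (initial inp)
      = (\<integral>\<^sup>+ v. ennreal (failure_bound k (if v \<noteq> Nul then x + 1 else x - 1)) \<partial>?D)"
    using assms by (intro wp_output) (simp add: answers_def)
  also have "\<dots> = (\<integral>\<^sup>+ v. ennreal (if v \<in> - {Nul} then failure_bound k (x + 1)
      else failure_bound k (x - 1)) \<partial>?D)"
    by (intro nn_integral_cong) simp
  also have "\<dots> = ennreal (measure_pmf.prob ?D (- {Nul}) * failure_bound k (x + 1)
      + measure_pmf.prob ?D {Nul} * failure_bound k (x - 1))"
    by (subst nn_integral_if_pmf) (simp_all add: failure_bound_nonneg)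
  also have "measure_pmf.prob ?D {Nul} = 1 - measure_pmf.prob ?D (- {Nul})"
    using measure_pmf.prob_compl[of "- {Nul}" ?D] by (simp flip: Compl_eq_Diff_UNIV)
  also have "ennreal (measure_pmf.prob ?D (- {Nul}) * failure_bound k (x + 1)
      + (1 - measure_pmf.prob ?D (- {Nul})) * failure_bound k (x - 1))
      \<le> ennreal (failure_bound (Suc k) x)"
    using assms measure_pmf.prob_compl[of "{Nul}" ?D]
    by (intro ennreal_leI failure_bound_Suc_ge) (auto simp: answers_def Compl_eq_Diff_UNIV)
  finally show ?thesis .
qed

section \<open>The approximation algorithm\<close>

definition query :: "real \<Rightarrow> nat \<Rightarrow> potts \<Rightarrow> real \<Rightarrow> val" where
  "query c K M y = Pair (Atom (real (K * order M) powr c))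
     (Pair (Atom (exp (real K * y))) (encode (copies K M)))"

definition displacement :: "real \<Rightarrow> real \<Rightarrow> real \<Rightarrow> real" where
  "displacement \<rho> Z y = (y - ln Z) / (\<rho> / 20)"

text \<open>Chosen so that for \<open>K\<close> copies the \<open>K\<close>-th root of the ratio \<open>(K n)\<^sup>c\<close> is at most \<open>exp (\<rho>/20)\<close>,
  one step of the search.\<close>

definition copy_count :: "real \<Rightarrow> nat \<Rightarrow> real \<Rightarrow> nat" where
  "copy_count c n \<rho> = nat \<lceil>2 + 1600 * c\<^sup>2 * real n / (\<rho> * \<rho>)\<rceil>"

text \<open>If \<open>B n\<^sup>2\<close> bounds \<open>\<bar>ln Z\<bar>\<close>, this is at least ten times the initial displacement, which suffices
  because \<open>(31/32)^10 \<le> 3/4\<close>.\<close>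

definition query_count :: "real \<Rightarrow> nat \<Rightarrow> real \<Rightarrow> nat" where
  "query_count B n \<rho> = nat \<lceil>200 * B * (real n * real n) / \<rho>\<rceil>"

definition add_copy_time :: "nat \<Rightarrow> nat" where
  "add_copy_time w = w * (5 * w + 19) + 19"

lemma add_copy_time_mono: "w \<le> w' \<Longrightarrow> add_copy_time w \<le> add_copy_time w'"
  by (simp add: add_copy_time_def mult_le_mono)

locale workspace =
  fixes m :: nat
  assumes m_pos: "m > 0"
begin

abbreviation (input) "v_rho \<equiv> m + 2"
abbreviation (input) "v_model \<equiv> m + 3"
abbreviation (input) "v_n \<equiv> m + 4"
abbreviation (input) "v_K \<equiv> m + 5"
abbreviation (input) "v_out \<equiv> m + 6"
abbreviation (input) "v_acc \<equiv> m + 7"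
abbreviation (input) "v_vertex \<equiv> m + 8"
abbreviation (input) "v_left \<equiv> m + 9"
abbreviation (input) "v_right \<equiv> m + 10"
abbreviation (input) "v_entry \<equiv> m + 11"
abbreviation (input) "v_row \<equiv> m + 12"
abbreviation (input) "v_ratio \<equiv> m + 13"
abbreviation (input) "v_y \<equiv> m + 14"
abbreviation (input) "v_i \<equiv> m + 15"
abbreviation (input) "v_lim \<equiv> m + 16"

definition push_entries :: "expr \<Rightarrow> expr \<Rightarrow> com" where
  "push_entries a e = Seq (Assign v_entry a) (push v_entry e v_row)"

definition push_vertex :: com where
  "push_vertex =
     Seq (Assign v_row NulE)
    (Seq (push_entries (Var v_left) NulE)
    (Seq (push_entries (Snd (Fst (Var v_vertex))) (Fst (Var v_entry)))
    (Seq (push_entries (Var v_right) NulE)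
         (Assign v_acc (PairE (PairE (Fst (Fst (Var v_vertex))) (Var v_row)) (Var v_acc))))))"

text \<open>Only the lengths of the lists \<open>l\<close> and \<open>r\<close> matter: they pad every adjacency row with non-edges.\<close>

definition push_vertices :: "expr \<Rightarrow> expr \<Rightarrow> expr \<Rightarrow> com" where
  "push_vertices l a r =
     Seq (Assign v_left l)
    (Seq (Assign v_right r)
    (Seq (Assign v_vertex a)
         (foreach v_vertex push_vertex)))"

definition add_copy :: com where
  "add_copy =
     Seq (Assign v_acc NulE)
    (Seq (push_vertices NulE (Var v_model) (Var v_out))
    (Seq (push_vertices (Var v_model) (Var v_out) NulE)
         (Assign v_out (Var v_acc))))"

definition read_input :: com where
  "read_input =
     Seq (Assign v_rho (Fst (Var 0)))
    (Seq (Assign v_model (Snd (Var 0)))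
    (Seq (Assign v_n (Const 0))
    (Seq (Assign v_vertex (Var v_model))
         (foreach v_vertex (Assign v_n (Add (Var v_n) (Const 1)))))))"

definition make_copies :: "real \<Rightarrow> com" where
  "make_copies c =
     Seq (Assign v_lim (Add (Const 2)
       (Div (Mul (Const (1600 * c\<^sup>2)) (Var v_n)) (Mul (Var v_rho) (Var v_rho)))))
    (Seq (Assign v_out NulE)
         (count_to v_K v_lim add_copy))"

definition start_search :: "real \<Rightarrow> real \<Rightarrow> com" where
  "start_search c B =
     Seq (Assign v_ratio (Exp (Mul (Const c) (Ln (Mul (Var v_K) (Var v_n))))))
    (Seq (Assign v_lim (Div (Mul (Const (200 * B)) (Mul (Var v_n) (Var v_n))) (Var v_rho)))
         (Assign v_y (Const 0)))"

definition prepare_query :: com where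
  "prepare_query =
     Seq (clear m)
       (Assign 0 (PairE (Var v_ratio) (PairE (Exp (Mul (Var v_K) (Var v_y))) (Var v_out))))"

definition update_estimate :: com where
  "update_estimate = Cond (Var 0)
     (Assign v_y (Add (Var v_y) (Div (Var v_rho) (Const 20))))
     (Assign v_y (Sub (Var v_y) (Div (Var v_rho) (Const 20))))"

definition search_step :: "com \<Rightarrow> com" where
  "search_step p = Seq prepare_query (Seq p update_estimate)"

definition search :: "com \<Rightarrow> com" where
  "search p = Seq (count_to v_i v_lim (search_step p)) (Assign 0 (Exp (Var v_y)))"

definition approximator :: "real \<Rightarrow> real \<Rightarrow> com \<Rightarrow> com" where
  "approximator c B p =
     Seq read_input
    (Seq (make_copies c)
    (Seq (start_search c B)
         (search p)))"

lemma ensures_push_entries: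
  assumes "evaluate a s = encode_list xs" "s v_row = encode_list ys"
    and "\<And>z zs w. evaluate e (s(v_entry := Pair z zs, v_row := w)) = f z"
    and "s1 = s(v_entry := Nul, v_row := encode_list (rev (map f xs) @ ys))"
  shows "ensures (5 * length xs + 3) (push_entries a e) (\<lambda>s'. s' = s1) s"
proof -
  let ?s = "s(v_entry := encode_list xs)"
  have "ensures (5 * length xs + 1) (push v_entry e v_row)
      (\<lambda>s'. s' = ?s(v_entry := Nul, v_row := encode_list (rev (map f xs) @ ys))) ?s"
    using assms(2,3) by (intro ensures_push) simp_all
  then have "ensures (5 * length xs + 1 + 2) (push_entries a e) (\<lambda>s'. s' = s1) s"
    unfolding push_entries_def by (intro ensures_Assign_Seq) (simp add: assms(1,4))
  then show ?thesis by (rule ensures_mono) simp_all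
qed

lemma ensures_push_vertex:
  assumes "s v_vertex = Pair (encode_vertex M v) vs"
    and "s v_left = encode_list ls" "s v_right = encode_list rs"
  defines "padded \<equiv> encode_padded_vertex (length ls) M (length rs) v"
  shows "ensures (5 * (length ls + order M + length rs) + 15) push_vertex
    (\<lambda>s'. s' = s(v_entry := Nul, v_row := right padded, v_acc := Pair padded (s v_acc))) s"
proof -
  let ?left = "replicate (length ls) Nul" and ?right = "replicate (length rs) Nul"
    and ?middle = "adjacency_row M v"
  let ?final = "s(v_entry := Nul, v_row := right padded, v_acc := Pair padded (s v_acc))"
  define with_row where "with_row xs = s(v_entry := Nul, v_row := encode_list (rev xs))" for xs
  have vertex: "s v_vertex = Pair (Pair (encode_fields M v) (encode_list ?middle)) vs"
    using assms(1) by (simp add: encode_vertex_eq)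
  have "ensures (5 * length ls + 3) (push_entries (Var v_left) NulE)
      (\<lambda>s'. s' = with_row ?left) (s(v_row := Nul))"
    by (rule ensures_push_entries[where f = "\<lambda>_. Nul" and ys = "[]"])
      (auto simp: with_row_def assms(2) map_replicate_const)
  moreover have "ensures (5 * order M + 3)
      (push_entries (Snd (Fst (Var v_vertex))) (Fst (Var v_entry)))
      (\<lambda>s'. s' = with_row (?left @ ?middle)) (with_row ?left)"
    unfolding length_adjacency_row[of M v, symmetric]
    by (rule ensures_push_entries[where f = "\<lambda>z. z"]) (auto simp: with_row_def vertex)
  moreover have "ensures (5 * length rs + 3) (push_entries (Var v_right) NulE)
      (\<lambda>s'. s' = with_row (?left @ ?middle @ ?right)) (with_row (?left @ ?middle))"
    by (rule ensures_push_entries[where f = "\<lambda>_. Nul" and ys = "rev (?left @ ?middle)"])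
      (auto simp: with_row_def assms(3) map_replicate_const)
  moreover have "ensures 1
      (Assign v_acc (PairE (PairE (Fst (Fst (Var v_vertex))) (Var v_row)) (Var v_acc)))
      (\<lambda>s'. s' = ?final) (with_row (?left @ ?middle @ ?right))"
    by (simp add: with_row_def padded_def encode_padded_vertex_def vertex)
  ultimately have
    "ensures (5 * length ls + 3 + (5 * order M + 3 + (5 * length rs + 3 + 1 + 1) + 1) + 1 + 2)
      push_vertex (\<lambda>s'. s' = ?final) s"
    unfolding push_vertex_def by (intro ensures_Assign_Seq ensures_Seq_eq) simp_all
  then show ?thesis by (rule ensures_mono) simp_all
qed

definition agree_off :: "nat set \<Rightarrow> store \<Rightarrow> store \<Rightarrow> bool" where
  "agree_off V s s' \<longleftrightarrow> (\<forall>x. x \<notin> V \<longrightarrow> s' x = s x)"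

definition copy_vars :: "nat set" where
  "copy_vars = {v_acc, v_vertex, v_left, v_right, v_entry, v_row}"

lemma ensures_foreach_push_vertex:
  assumes "s v_vertex = encode_list (map (encode_vertex M) vs)"
    and "s v_left = encode_list ls" "s v_right = encode_list rs" "s v_acc = encode_list xs"
  shows "ensures (length vs * (5 * (length ls + order M + length rs) + 19) + 1)
    (foreach v_vertex push_vertex)
    (\<lambda>s'. agree_off copy_vars s s' \<and> s' v_acc = encode_list
      (rev (map (encode_padded_vertex (length ls) M (length rs)) vs) @ xs)) s"
  using assms
proof (induction vs arbitrary: s xs)
  case Nil
  then show ?case by (simp add: ensures_foreach_Nul agree_off_def)
next
  case (Cons v vs)
  let ?t = "5 * (length ls + order M + length rs) + 15"
  let ?padded = "encode_padded_vertex (length ls) M (length rs)"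
  let ?s = "s(v_entry := Nul, v_row := right (?padded v), v_acc := encode_list (?padded v # xs),
    v_vertex := encode_list (map (encode_vertex M) vs))"
  let ?Q = "\<lambda>s'. agree_off copy_vars s s' \<and> s' v_acc = encode_list (rev (map ?padded (v # vs)) @ xs)"
  have vertex: "s v_vertex = Pair (encode_vertex M v) (encode_list (map (encode_vertex M) vs))"
    using Cons.prems(1) by simp
  have "ensures (length vs * (?t + 4) + 1) (foreach v_vertex push_vertex) ?Q ?s"
    by (rule ensures_mono[OF Cons.IH[of ?s "?padded v # xs"]])
      (simp_all add: Cons.prems(2-4) agree_off_def copy_vars_def)
  then have "ensures ?t push_vertex (\<lambda>s'. ensures (length vs * (?t + 4) + 1)
      (foreach v_vertex push_vertex) ?Q (s'(v_vertex := right (s' v_vertex)))) s"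
    by (intro ensures_mono[OF ensures_push_vertex[OF vertex Cons.prems(2,3)] order_refl])
      (simp add: vertex Cons.prems(4))
  from ensures_foreach_Pair[OF vertex this] show ?case
    by (rule ensures_mono) simp_all
qed

lemma ensures_push_vertices:
  assumes "evaluate l s = encode_list ls" "\<And>x. evaluate r (s(v_left := x)) = encode_list rs"
    and "\<And>x x'. evaluate a (s(v_left := x, v_right := x')) = encode M" "s v_acc = encode_list xs"
  shows "ensures (order M * (5 * (length ls + order M + length rs) + 19) + 7) (push_vertices l a r)
    (\<lambda>s'. agree_off copy_vars s s' \<and> s' v_acc = encode_list
      (rev (map (encode_padded_vertex (length ls) M (length rs)) [0..<order M]) @ xs)) s"
    (is "ensures _ _ ?Q s")
proof -
  let ?s = "s(v_left := encode_list ls, v_right := encode_list rs, v_vertex := encode M)"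
  have "ensures (length [0..<order M] * (5 * (length ls + order M + length rs) + 19) + 1)
      (foreach v_vertex push_vertex) ?Q ?s"
    by (rule ensures_mono[OF ensures_foreach_push_vertex[of ?s]])
      (auto simp: assms(4) encode_def agree_off_def copy_vars_def)
  then have
    "ensures (length [0..<order M] * (5 * (length ls + order M + length rs) + 19) + 1 + 2 + 2 + 2)
      (push_vertices l a r) ?Q s"
    unfolding push_vertices_def by (intro ensures_Assign_Seq) (simp only: assms(1-3))
  then show ?thesis by (rule ensures_mono) simp_all
qed

lemma ensures_add_copy:
  assumes "simple M" "simple N" "spins M = spins N"
    and model: "s v_model = encode M" and out: "s v_out = encode N"
  shows "ensures (add_copy_time (order M + order N)) add_copy
    (\<lambda>s'. agree_off (insert v_out copy_vars) s s' \<and> s' v_out = encode (disjoint_union M N)) s"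
    (is "ensures _ _ ?R s")
proof -
  let ?m = "order M" and ?n = "order N"
  let ?padded_M = "map (encode_padded_vertex 0 M ?n) [0..<?m]"
    and ?padded_N = "map (encode_padded_vertex ?m N 0) [0..<?n]"
  let ?Q = "\<lambda>xs s'. agree_off copy_vars s s' \<and> s' v_acc = encode_list xs"
  have push_M: "ensures (?m * (5 * (?m + ?n) + 19) + 7) (push_vertices NulE (Var v_model) (Var v_out))
      (?Q (rev ?padded_M)) (s(v_acc := Nul))"
    using ensures_push_vertices[of NulE "s(v_acc := Nul)" "[]" "Var v_out"
        "map (encode_vertex N) [0..<?n]" "Var v_model" M "[]"]
    by (rule ensures_mono) (auto simp: model out encode_def agree_off_def copy_vars_def)
  have push_N: "ensures (?n * (5 * (?m + ?n) + 19) + 7) (push_vertices (Var v_model) (Var v_out) NulE)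
      (?Q (rev ?padded_N @ rev ?padded_M)) s1" if "?Q (rev ?padded_M) s1" for s1
    using that model out
    by (intro ensures_mono[OF ensures_push_vertices[of "Var v_model" s1
            "map (encode_vertex M) [0..<?m]" NulE "[]" "Var v_out" N "rev ?padded_M"]])
      (auto simp: encode_def agree_off_def copy_vars_def)
  have "encode (disjoint_union M N) = encode_list (rev (?padded_M @ ?padded_N))"
    using assms(1-3) by (intro simple_models.encode_disjoint_union simple_models.intro)
  then have "ensures 1 (Assign v_out (Var v_acc)) ?R s2"
    if "?Q (rev ?padded_N @ rev ?padded_M) s2" for s2
    using that by (simp add: agree_off_def)
  then have "ensures (?n * (5 * (?m + ?n) + 19) + 7 + 1 + 1)
      (Seq (push_vertices (Var v_model) (Var v_out) NulE) (Assign v_out (Var v_acc))) ?R s1"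
    if "?Q (rev ?padded_M) s1" for s1
    by (intro ensures_Seq ensures_mono[OF push_N[OF that] order_refl])
  then have "ensures (?m * (5 * (?m + ?n) + 19) + 7 + (?n * (5 * (?m + ?n) + 19) + 7 + 1 + 1) + 1 + 2)
      add_copy ?R s"
    unfolding add_copy_def
    by (intro ensures_Assign_Seq ensures_Seq)
      (simp only: evaluate.simps ensures_mono[OF push_M order_refl])
  then show ?thesis
    by (rule ensures_mono) (simp_all add: add_copy_time_def algebra_simps)
qed

definition input_read :: "real \<Rightarrow> potts \<Rightarrow> store \<Rightarrow> bool" where
  "input_read \<rho> M s \<longleftrightarrow> s v_rho = Atom \<rho> \<and> s v_model = encode M \<and> s v_n = Atom (real (order M))"

lemma ensures_read_input:
  assumes "s 0 = Pair (Atom \<rho>) (encode M)"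
  shows "ensures (5 * order M + 9) read_input (input_read \<rho> M) s"
proof -
  let ?s = "s(v_rho := Atom \<rho>, v_model := encode M, v_n := Atom 0, v_vertex := encode M)"
  let ?vertices = "map (encode_vertex M) [0..<order M]"
  have "ensures (5 * length ?vertices + 1) (foreach v_vertex (Assign v_n (Add (Var v_n) (Const 1))))
      (\<lambda>s'. s' = ?s(v_vertex := Nul, v_n := fold (\<lambda>_ w. Atom (num w + 1)) ?vertices (?s v_n))) ?s"
    by (rule ensures_foreach_Assign) (simp_all add: encode_def)
  then have "ensures (5 * order M + 1) (foreach v_vertex (Assign v_n (Add (Var v_n) (Const 1))))
      (input_read \<rho> M) ?s"
    by (rule ensures_mono) (simp_all add: input_read_def fold_increment)
  then have "ensures (5 * order M + 1 + 2 + 2 + 2 + 2) read_input (input_read \<rho> M) s"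
    unfolding read_input_def using assms by (intro ensures_Assign_Seq) simp
  then show ?thesis by (rule ensures_mono) simp_all
qed

lemma ensures_make_copies:
  fixes c :: real
  assumes "input_read \<rho> M s" "simple M"
  defines "K \<equiv> copy_count c (order M) \<rho>"
  shows "ensures (K * (add_copy_time (K * order M) + 4) + 7) (make_copies c)
    (\<lambda>s'. input_read \<rho> M s' \<and> s' v_K = Atom (real K) \<and> s' v_out = encode (copies K M)) s"
proof -
  let ?l = "2 + 1600 * c\<^sup>2 * real (order M) / (\<rho> * \<rho>)"
  let ?s = "s(v_lim := Atom ?l, v_out := Nul)"
  let ?I = "\<lambda>k s'. input_read \<rho> M s' \<and> s' v_lim = Atom ?l \<and> s' v_K = Atom (real k)
    \<and> s' v_out = encode (copies k M)"
  have K: "K = nat \<lceil>?l\<rceil>" by (simp add: K_def copy_count_def)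
  have "ensures (K * (add_copy_time (K * order M) + 4) + 3) (count_to v_K v_lim add_copy) (?I K) ?s"
    unfolding K
  proof (rule ensures_count_to)
    fix k s1 assume k: "k < nat \<lceil>?l\<rceil>" and I: "?I k s1"
    have "Suc k * order M \<le> K * order M"
      using k unfolding K by (intro mult_right_mono) auto
    then have "add_copy_time (order M + k * order M) \<le> add_copy_time (nat \<lceil>?l\<rceil> * order M)"
      unfolding K by (intro add_copy_time_mono) simp
    moreover have "ensures (add_copy_time (order M + order (copies k M))) add_copy
        (\<lambda>s'. agree_off (insert v_out copy_vars) s1 s'
          \<and> s' v_out = encode (disjoint_union M (copies k M))) s1"
      using I assms(2) simple_copies by (intro ensures_add_copy) (auto simp: input_read_def)
    ultimately show "ensures (add_copy_time (nat \<lceil>?l\<rceil> * order M)) add_copy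
        (\<lambda>s'. ?I (Suc k) (s'(v_K := Atom (num (s' v_K) + 1)))) s1"
      using I by (elim ensures_mono) (auto simp: input_read_def agree_off_def copy_vars_def)
  qed (use assms(1) in \<open>auto simp: input_read_def encode_def\<close>)
  then have "ensures (K * (add_copy_time (K * order M) + 4) + 3) (count_to v_K v_lim add_copy)
      (\<lambda>s'. input_read \<rho> M s' \<and> s' v_K = Atom (real K) \<and> s' v_out = encode (copies K M)) ?s"
    by (rule ensures_mono) simp_all
  then have "ensures (K * (add_copy_time (K * order M) + 4) + 3 + 2 + 2) (make_copies c)
      (\<lambda>s'. input_read \<rho> M s' \<and> s' v_K = Atom (real K) \<and> s' v_out = encode (copies K M)) s"
    unfolding make_copies_def using assms(1) by (intro ensures_Assign_Seq) (simp add: input_read_def)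
  then show ?thesis by (rule ensures_mono) simp_all
qed


definition search_ready :: "real \<Rightarrow> real \<Rightarrow> nat \<Rightarrow> potts \<Rightarrow> store \<Rightarrow> bool" where
  "search_ready c \<rho> K M s \<longleftrightarrow> s v_rho = Atom \<rho> \<and> s v_K = Atom (real K) \<and> s v_out = encode (copies K M)
     \<and> s v_ratio = Atom (real (K * order M) powr c)"

lemma ensures_start_search:
  assumes "input_read \<rho> M s" "s v_K = Atom (real K)" "s v_out = encode (copies K M)" "K * order M > 0"
  shows "ensures 5 (start_search c B) (\<lambda>s'. search_ready c \<rho> K M s' \<and> s' v_y = Atom 0
    \<and> s' v_lim = Atom (200 * B * (real (order M) * real (order M)) / \<rho>)) s"
proof -
  have "ensures (1 + 2 + 2) (start_search c B) (\<lambda>s'. search_ready c \<rho> K M s' \<and> s' v_y = Atom 0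
      \<and> s' v_lim = Atom (200 * B * (real (order M) * real (order M)) / \<rho>)) s"
    unfolding start_search_def using assms
    by (intro ensures_Assign_Seq) (simp add: search_ready_def input_read_def powr_def)
  then show ?thesis by (rule ensures_mono) simp_all
qed

lemma ensures_prepare_query:
  assumes "search_ready c \<rho> K M s"
  shows "ensures (2 * m + 2) prepare_query
    (\<lambda>s'. s' = overlay m (initial (query c K M (num (s v_y)))) s) s"
proof -
  have "(overlay m (\<lambda>_. Nul) s)(0 := v) = overlay m (initial v) s" for v
    using m_pos by (simp add: overlay_upd)
  then have "ensures 1
      (Assign 0 (PairE (Var v_ratio) (PairE (Exp (Mul (Var v_K) (Var v_y))) (Var v_out))))
      (\<lambda>s'. s' = overlay m (initial (query c K M (num (s v_y)))) s) (overlay m (\<lambda>_. Nul) s)"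
    using assms by (simp add: search_ready_def query_def)
  from ensures_Seq_eq[OF ensures_clear this] show ?thesis
    unfolding prepare_query_def by (rule ensures_mono) simp_all
qed

lemma ensures_update_estimate:
  assumes "s v_rho = Atom \<rho>"
  shows "ensures 2 update_estimate (\<lambda>s'. s' = s(v_y := Atom
    (if s 0 \<noteq> Nul then num (s v_y) + \<rho> / 20 else num (s v_y) - \<rho> / 20))) s"
proof -
  have "ensures (Suc 1) update_estimate (\<lambda>s'. s' = s(v_y := Atom
      (if s 0 \<noteq> Nul then num (s v_y) + \<rho> / 20 else num (s v_y) - \<rho> / 20))) s"
    unfolding update_estimate_def using assms by (intro ensures_Cond) simp
  then show ?thesis by (simp add: numeral_2_eq_2)
qed

lemma wp_update_estimate_overlay_le:
  assumes "\<rho> > 0" and ready: "search_ready c \<rho> K M s"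
    and post: "\<And>s'. search_ready c \<rho> K M s' \<Longrightarrow> s' v_i = s v_i \<Longrightarrow> s' v_lim = s v_lim \<Longrightarrow>
      f s' \<le> ennreal (failure_bound k (displacement \<rho> Z (num (s' v_y))))"
  defines "x \<equiv> displacement \<rho> Z (num (s v_y))"
  shows "wp 2 update_estimate f (overlay m s'' s)
    \<le> ennreal (failure_bound k (if s'' 0 \<noteq> Nul then x + 1 else x - 1))"
proof -
  let ?s = "overlay m s'' s"
  define y where "y = (if s'' 0 \<noteq> Nul then num (s v_y) + \<rho> / 20 else num (s v_y) - \<rho> / 20)"
  have "displacement \<rho> Z y = (if s'' 0 \<noteq> Nul then x + 1 else x - 1)"
    using assms(1) by (simp add: y_def x_def displacement_def field_simps)
  moreover have "search_ready c \<rho> K M (?s(v_y := Atom y))"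
    using ready by (simp add: search_ready_def)
  ultimately have "f (?s(v_y := Atom y))
      \<le> ennreal (failure_bound k (if s'' 0 \<noteq> Nul then x + 1 else x - 1))"
    using post[of "?s(v_y := Atom y)"] by simp
  moreover have "?s v_rho = Atom \<rho>"
    using ready by (simp add: search_ready_def)
  from ensures_update_estimate[of ?s, OF this]
  have "ensures 2 update_estimate (\<lambda>s'. s' = ?s(v_y := Atom y)) ?s"
    by (rule ensures_mono) (simp_all add: y_def m_pos)
  ultimately show ?thesis by (auto intro: wp_le_if_ensures)
qed

lemma wp_search_step_le:
  assumes p: "cvars p \<subseteq> {..<m}" and "\<rho> > 0" and ready: "search_ready c \<rho> K M s"
    and post: "\<And>s'. search_ready c \<rho> K M s' \<Longrightarrow> s' v_i = s v_i \<Longrightarrow> s' v_lim = s v_lim \<Longrightarrow>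
      f s' \<le> ennreal (failure_bound k (displacement \<rho> Z (num (s' v_y))))"
  defines "x \<equiv> displacement \<rho> Z (num (s v_y))"
  assumes answers: "answers p (query c K M (num (s v_y))) t (x \<ge> 1) (x \<le> -1)"
  shows "wp (2 * m + t + 6) (search_step p) f s \<le> ennreal (failure_bound (Suc k) x)"
proof -
  let ?inp = "initial (query c K M (num (s v_y)))"
  have "wp (t + 2 + 1) (Seq p update_estimate) f (overlay m ?inp s)
      \<le> wp t p (wp 2 update_estimate f) (overlay m ?inp s)"
    by (rule wp_Seq)
  also have "\<dots> = wp t p (\<lambda>s''. wp 2 update_estimate f (overlay m s'' s)) ?inp"
    by (rule wp_overlay[OF p])
  also have "\<dots> \<le> wp t p (\<lambda>s''. ennreal (failure_bound k (if s'' 0 \<noteq> Nul then x + 1 else x - 1))) ?inp"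
    unfolding x_def using assms(2) ready post by (intro wp_mono wp_update_estimate_overlay_le)
  also have "\<dots> \<le> ennreal (failure_bound (Suc k) x)"
    by (rule wp_failure_bound_le_if_answers[OF answers])
  finally have "wp (t + 2 + 1) (Seq p update_estimate) f (overlay m ?inp s)
    \<le> ennreal (failure_bound (Suc k) x)" .
  then have "wp (2 * m + 2 + (t + 2 + 1) + 1) (search_step p) f s \<le> ennreal (failure_bound (Suc k) x)"
    unfolding search_step_def by (intro wp_Seq_le_if_ensures[OF ensures_prepare_query[OF ready]]) simp
  then show ?thesis by (simp add: numeral_eq_Suc add_ac)
qed

lemma wp_count_to_search_step_le:
  fixes l :: real
  assumes p: "cvars p \<subseteq> {..<m}" and \<rho>: "\<rho> > 0"
    and ready: "search_ready c \<rho> K M s" and lim: "s v_lim = Atom l"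
    and answers: "\<And>y. \<exists>t\<le>T. answers p (query c K M y) t
      (displacement \<rho> Z y \<ge> 1) (displacement \<rho> Z y \<le> -1)"
    and post: "\<And>s'. f s' \<le> ennreal (failure_bound 0 (displacement \<rho> Z (num (s' v_y))))"
  defines "N \<equiv> nat \<lceil>l\<rceil>"
  shows "wp (N * (2 * m + T + 10) + 3) (count_to v_i v_lim (search_step p)) f s
    \<le> ennreal (failure_bound N (displacement \<rho> Z (num (s v_y))))"
proof -
  let ?I = "\<lambda>k s'. search_ready c \<rho> K M s' \<and> s' v_i = Atom (real k) \<and> s' v_lim = Atom l"
  define J where "J k s' = (if ?I k s'
    then ennreal (failure_bound (N - k) (displacement \<rho> Z (num (s' v_y)))) else \<top>)" for k s'
  have "wp (N * ((2 * m + T + 6) + 4) + 3) (count_to v_i v_lim (search_step p)) f s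
      \<le> J 0 (s(v_i := Atom 0))"
    unfolding N_def
  proof (rule wp_count_to_le)
    fix k s1 assume k: "k < nat \<lceil>l\<rceil>" and "J k s1 < \<top>"
    then have I: "?I k s1" by (auto simp: J_def split: if_splits)
    obtain t where t: "t \<le> T" "answers p (query c K M (num (s1 v_y))) t
        (displacement \<rho> Z (num (s1 v_y)) \<ge> 1) (displacement \<rho> Z (num (s1 v_y)) \<le> -1)"
      using answers by blast
    have "wp (2 * m + T + 6) (search_step p) (\<lambda>s'. J (Suc k) (s'(v_i := Atom (num (s' v_i) + 1)))) s1
        \<le> wp (2 * m + t + 6) (search_step p) (\<lambda>s'. J (Suc k) (s'(v_i := Atom (num (s' v_i) + 1)))) s1"
      using t(1) by (intro wp_antimono) simp
    also have "\<dots> \<le> ennreal (failure_bound (Suc (N - Suc k)) (displacement \<rho> Z (num (s1 v_y))))"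
      using I t(2) by (intro wp_search_step_le[OF p \<rho>]) (auto simp: J_def search_ready_def)
    also have "\<dots> = J k s1"
      using I k by (simp add: J_def N_def Suc_diff_Suc)
    finally show "wp (2 * m + T + 6) (search_step p)
        (\<lambda>s'. J (Suc k) (s'(v_i := Atom (num (s' v_i) + 1)))) s1 \<le> J k s1" .
  qed (use post in \<open>auto simp: J_def N_def split: if_splits\<close>)
  also have "J 0 (s(v_i := Atom 0)) = ennreal (failure_bound N (displacement \<rho> Z (num (s v_y))))"
    using ready lim by (simp add: J_def search_ready_def)
  finally show ?thesis by (simp add: algebra_simps)
qed

end

section \<open>Polynomial bounds\<close>

definition poly_bounded :: "(nat \<Rightarrow> real \<Rightarrow> real) \<Rightarrow> bool" where
  "poly_bounded f \<longleftrightarrow> (\<exists>C k. \<forall>n\<ge>1. \<forall>\<rho>>0. \<bar>f n \<rho>\<bar> \<le> C * (real n + 1 / \<rho>) ^ k)"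

lemma poly_boundedE:
  assumes "poly_bounded f"
  obtains C k where "C \<ge> 0" "\<And>n \<rho> j. n \<ge> 1 \<Longrightarrow> \<rho> > 0 \<Longrightarrow> j \<ge> k \<Longrightarrow> \<bar>f n \<rho>\<bar> \<le> C * (real n + 1 / \<rho>) ^ j"
proof -
  obtain C k where f: "\<And>n \<rho>. n \<ge> 1 \<Longrightarrow> \<rho> > 0 \<Longrightarrow> \<bar>f n \<rho>\<bar> \<le> C * (real n + 1 / \<rho>) ^ k"
    using assms unfolding poly_bounded_def by blast
  have "\<bar>f n \<rho>\<bar> \<le> \<bar>C\<bar> * (real n + 1 / \<rho>) ^ j" if "n \<ge> 1" "\<rho> > 0" "j \<ge> k" for n \<rho> j
  proof -
    have "real n + 1 / \<rho> \<ge> 1" using that by (simp add: add_increasing2)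
    then have "C * (real n + 1 / \<rho>) ^ k \<le> \<bar>C\<bar> * (real n + 1 / \<rho>) ^ j"
      using that(3) by (intro mult_mono power_increasing) auto
    with f[OF that(1,2)] show ?thesis by linarith
  qed
  then show thesis using that[of "\<bar>C\<bar>" k] by simp
qed

lemma poly_bounded_mono:
  assumes "poly_bounded g" and "\<And>n \<rho>. n \<ge> 1 \<Longrightarrow> \<rho> > 0 \<Longrightarrow> \<bar>f n \<rho>\<bar> \<le> \<bar>g n \<rho>\<bar>"
  shows "poly_bounded f"
  using assms unfolding poly_bounded_def by (meson order_trans)

lemma poly_bounded_const: "poly_bounded (\<lambda>n \<rho>. a)"
  unfolding poly_bounded_def by (rule exI[of _ "\<bar>a\<bar>"], rule exI[of _ 0]) simp

lemma poly_bounded_size: "poly_bounded (\<lambda>n \<rho>. real n)"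
  unfolding poly_bounded_def by (rule exI[of _ 1], rule exI[of _ 1]) simp

lemma poly_bounded_inverse_precision: "poly_bounded (\<lambda>n \<rho>. 1 / \<rho>)"
  unfolding poly_bounded_def by (rule exI[of _ 1], rule exI[of _ 1]) simp

lemma poly_bounded_add:
  assumes "poly_bounded f" "poly_bounded g"
  shows "poly_bounded (\<lambda>n \<rho>. f n \<rho> + g n \<rho>)"
proof -
  obtain C k where f: "\<And>n \<rho> j. n \<ge> 1 \<Longrightarrow> \<rho> > 0 \<Longrightarrow> j \<ge> k \<Longrightarrow> \<bar>f n \<rho>\<bar> \<le> C * (real n + 1 / \<rho>) ^ j"
    using assms(1) by (rule poly_boundedE) (blast intro: that)
  obtain C' k' where g: "\<And>n \<rho> j. n \<ge> 1 \<Longrightarrow> \<rho> > 0 \<Longrightarrow> j \<ge> k' \<Longrightarrow> \<bar>g n \<rho>\<bar> \<le> C' * (real n + 1 / \<rho>) ^ j"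
    using assms(2) by (rule poly_boundedE) (blast intro: that)
  have "\<bar>f n \<rho> + g n \<rho>\<bar> \<le> (C + C') * (real n + 1 / \<rho>) ^ (max k k')" if "n \<ge> 1" "\<rho> > 0" for n \<rho>
    using f[OF that, of "max k k'"] g[OF that, of "max k k'"] by (simp add: distrib_right)
  then show ?thesis unfolding poly_bounded_def by blast
qed

lemma poly_bounded_mult:
  assumes "poly_bounded f" "poly_bounded g"
  shows "poly_bounded (\<lambda>n \<rho>. f n \<rho> * g n \<rho>)"
proof -
  obtain C k where C: "C \<ge> 0"
    and f: "\<And>n \<rho> j. n \<ge> 1 \<Longrightarrow> \<rho> > 0 \<Longrightarrow> j \<ge> k \<Longrightarrow> \<bar>f n \<rho>\<bar> \<le> C * (real n + 1 / \<rho>) ^ j"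
    using assms(1) by (rule poly_boundedE) (blast intro: that)
  obtain C' k' where g: "\<And>n \<rho> j. n \<ge> 1 \<Longrightarrow> \<rho> > 0 \<Longrightarrow> j \<ge> k' \<Longrightarrow> \<bar>g n \<rho>\<bar> \<le> C' * (real n + 1 / \<rho>) ^ j"
    using assms(2) by (rule poly_boundedE) (blast intro: that)
  have "\<bar>f n \<rho> * g n \<rho>\<bar> \<le> (C * C') * (real n + 1 / \<rho>) ^ (k + k')" if "n \<ge> 1" "\<rho> > 0" for n \<rho>
  proof -
    have "\<bar>f n \<rho>\<bar> * \<bar>g n \<rho>\<bar> \<le> (C * (real n + 1 / \<rho>) ^ k) * (C' * (real n + 1 / \<rho>) ^ k')"
      using f[OF that order_refl] g[OF that order_refl] C that by (intro mult_mono) auto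
    then show ?thesis by (simp add: abs_mult power_add mult_ac)
  qed
  then show ?thesis unfolding poly_bounded_def by blast
qed

lemma poly_bounded_power: "poly_bounded f \<Longrightarrow> poly_bounded (\<lambda>n \<rho>. f n \<rho> ^ k)"
  by (induction k) (auto intro: poly_bounded_mult poly_bounded_const[of 1, simplified])

lemmas poly_bounded_intros = poly_bounded_const poly_bounded_size poly_bounded_inverse_precision
  poly_bounded_add poly_bounded_mult poly_bounded_power

lemma poly_bounded_nat_ceiling:
  assumes "poly_bounded f"
  shows "poly_bounded (\<lambda>n \<rho>. real (nat \<lceil>f n \<rho>\<rceil>))"
proof -
  have "poly_bounded (\<lambda>n \<rho>. \<bar>f n \<rho>\<bar>)"
    using assms by (simp add: poly_bounded_def)
  then have "poly_bounded (\<lambda>n \<rho>. \<bar>f n \<rho>\<bar> + 1)"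
    by (intro poly_bounded_intros)
  moreover have "\<bar>real (nat \<lceil>x\<rceil>)\<bar> \<le> \<bar>\<bar>x\<bar> + 1\<bar>" for x :: real
    by linarith
  ultimately show ?thesis by (rule poly_bounded_mono)
qed

lemma poly_bounded_nat_floor:
  assumes "poly_bounded f"
  shows "poly_bounded (\<lambda>n \<rho>. real (nat \<lfloor>f n \<rho>\<rfloor>))"
proof (rule poly_bounded_mono[OF assms])
  fix n \<rho>
  show "\<bar>real (nat \<lfloor>f n \<rho>\<rfloor>)\<bar> \<le> \<bar>f n \<rho>\<bar>" by linarith
qed

lemma poly_bounded_copy_count: "poly_bounded (\<lambda>n \<rho>. real (copy_count c n \<rho>))"
proof -
  have "poly_bounded (\<lambda>n \<rho>. 2 + 1600 * c\<^sup>2 * real n * ((1 / \<rho>) * (1 / \<rho>)))"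
    by (intro poly_bounded_intros)
  from poly_bounded_nat_ceiling[OF this] show ?thesis
    by (simp add: copy_count_def)
qed

lemma poly_bounded_query_count: "poly_bounded (\<lambda>n \<rho>. real (query_count B n \<rho>))"
proof -
  have "poly_bounded (\<lambda>n \<rho>. 200 * B * (real n * real n) * (1 / \<rho>))"
    by (intro poly_bounded_intros)
  from poly_bounded_nat_ceiling[OF this] show ?thesis
    by (simp add: query_count_def)
qed

lemma copy_count_ge_2: "copy_count c n \<rho> \<ge> 2"
proof -
  have "2 \<le> 2 + 1600 * c\<^sup>2 * real n / (\<rho> * \<rho>)" by simp
  then show ?thesis unfolding copy_count_def by linarith
qed

lemma ln_ratio_le_copy_count:
  assumes "n \<ge> 1" "\<rho> > 0" "c > 0"
  defines "K \<equiv> copy_count c n \<rho>"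
  shows "c * ln (real (K * n)) \<le> real K * (\<rho> / 20)"
proof -
  have pos: "real (K * n) > 0"
    using copy_count_ge_2[of c n \<rho>] assms(1) by (simp add: K_def)
  have "2 + 1600 * c\<^sup>2 * real n / (\<rho> * \<rho>) \<le> real K"
    unfolding K_def copy_count_def by linarith
  then have "1600 * c\<^sup>2 * real n / (\<rho> * \<rho>) \<le> real K" by linarith
  then have "1600 * c\<^sup>2 * real n \<le> real K * (\<rho> * \<rho>)"
    using assms(2) by (simp add: divide_le_eq)
  then have "real K * (1600 * c\<^sup>2 * real n) \<le> real K * (real K * (\<rho> * \<rho>))"
    by (rule mult_left_mono) simp
  moreover have "(40 * c * sqrt (real (K * n)))\<^sup>2 = real K * (1600 * c\<^sup>2 * real n)"
    by (simp add: power_mult_distrib)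
  moreover have "(real K * \<rho>)\<^sup>2 = real K * (real K * (\<rho> * \<rho>))"
    by (simp add: power2_eq_square mult_ac)
  ultimately have "(40 * c * sqrt (real (K * n)))\<^sup>2 \<le> (real K * \<rho>)\<^sup>2"
    by (simp only:)
  then have "40 * c * sqrt (real (K * n)) \<le> real K * \<rho>"
    by (rule power2_le_imp_le) (use assms(2) in simp)
  moreover have "ln (real (K * n)) \<le> 2 * sqrt (real (K * n))"
    using ln_sqrt[of "real (K * n)"] ln_le_minus_one[of "sqrt (real (K * n))"] pos by simp
  then have "c * ln (real (K * n)) \<le> c * (2 * sqrt (real (K * n)))"
    using assms(3) by (intro mult_left_mono) auto
  ultimately show ?thesis by simp
qed

lemma failure_bound_query_count_le:
  assumes "\<bar>ln Z\<bar> \<le> B * (real n)\<^sup>2" "\<rho> > 0"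
  shows "failure_bound (query_count B n \<rho>) (displacement \<rho> Z 0) \<le> 1/4"
proof (rule failure_bound_le)
  have "10 * \<bar>displacement \<rho> Z 0\<bar> = 200 * \<bar>ln Z\<bar> / \<rho>"
    using assms(2) by (simp add: displacement_def abs_mult)
  also have "\<dots> \<le> 200 * (B * (real n)\<^sup>2) / \<rho>"
    using assms by (intro divide_right_mono mult_left_mono) auto
  also have "\<dots> \<le> real (query_count B n \<rho>)"
    unfolding query_count_def power2_eq_square mult.assoc by (rule real_nat_ceiling_ge)
  finally show "10 * \<bar>displacement \<rho> Z 0\<bar> \<le> real (query_count B n \<rho>)" .
qed

lemma displacement_ge_1D:
  assumes "displacement \<rho> Z y \<ge> 1" "\<rho> > 0" "K \<ge> 0" "r \<le> K * (\<rho> / 20)"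
  shows "exp (K * ln Z) \<le> exp (K * y) / exp r"
proof -
  have "K * (\<rho> / 20) \<le> K * (y - ln Z)"
    using assms(1-3) by (intro mult_left_mono) (auto simp: displacement_def field_simps)
  with assms(4) show ?thesis
    by (simp add: right_diff_distrib flip: exp_diff)
qed

lemma displacement_le_minus_1D:
  assumes "displacement \<rho> Z y \<le> -1" "\<rho> > 0" "K \<ge> 0" "r \<le> K * (\<rho> / 20)"
  shows "exp r * exp (K * y) \<le> exp (K * ln Z)"
proof -
  have "K * (\<rho> / 20) \<le> K * (ln Z - y)"
    using assms(1-3) by (intro mult_left_mono) (auto simp: displacement_def field_simps)
  with assms(4) show ?thesis
    by (simp add: right_diff_distrib flip: exp_add)
qed

definition approximations :: "real \<Rightarrow> real \<Rightarrow> val set" where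
  "approximations \<rho> Z = {Atom z | z. exp (- \<rho>) * Z \<le> z \<and> z \<le> exp \<rho> * Z}"

lemma indicator_le_failure_bound:
  assumes "Z > 0" "\<rho> > 0"
  shows "indicator (- approximations \<rho> Z) (Atom (exp y))
    \<le> ennreal (failure_bound 0 (displacement \<rho> Z y))"
proof (cases "\<bar>y - ln Z\<bar> \<le> \<rho>")
  case True
  then have "exp (ln Z - \<rho>) \<le> exp y" "exp y \<le> exp (ln Z + \<rho>)" by simp_all
  then have "Atom (exp y) \<in> approximations \<rho> Z"
    using assms(1) by (simp add: approximations_def exp_add exp_diff exp_minus field_simps)
  then show ?thesis by simp
next
  case False
  then have "20 \<le> \<bar>displacement \<rho> Z y\<bar>"
    using assms(2) by (simp add: displacement_def field_simps)
  then have "1 \<le> failure_bound 0 (displacement \<rho> Z y)"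
    by (rule failure_bound_0_ge)
  then show ?thesis
    by (auto simp: indicator_def simp flip: ennreal_1 intro: ennreal_leI)
qed

locale decision_procedure = workspace m for m :: nat +
  fixes q d k :: nat and b h c C :: real and p :: com
  assumes q_pos: "q \<ge> 1" and h_nonneg: "h \<ge> 0" and c_pos: "c > 0" and vars_below: "cvars p \<subseteq> {..<m}"
    and decides: "decides_within (uniform_models q d b h) (\<lambda>n. real n powr c) p (\<lambda>n. C * real n ^ k)"
begin

lemma answers_query:
  assumes M: "M \<in> uniform_models q d b h n" and "n \<ge> 1" "\<rho> > 0"
  defines "K \<equiv> copy_count c n \<rho>" and "Z \<equiv> partition_function M"
  shows "\<exists>t\<le>nat \<lfloor>C * real (K * n) ^ k\<rfloor>.
    answers p (query c K M y) t (displacement \<rho> Z y \<ge> 1) (displacement \<rho> Z y \<le> -1)"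
proof -
  define r where "r = real (K * n) powr c"
  have "2 * 1 \<le> K * n"
    using copy_count_ge_2 assms(2) unfolding K_def by (intro mult_le_mono)
  then have Kn: "K * n \<ge> 1" "real (K * n) > 1"
    by linarith+
  then have "r > 1" and r: "r = exp (c * ln (real (K * n)))"
    using gr_one_powr[OF _ c_pos] by (simp_all add: r_def powr_def del: of_nat_mult)
  have Z_copies: "partition_function (copies K M) = exp (real K * ln Z)"
    using partition_function_copies[OF uniform_models_simple[OF M]] partition_function_pos[OF M q_pos]
    by (simp add: Z_def exp_of_nat_mult)
  obtain t where t: "real t \<le> C * real (K * n) ^ k" "answers p (query c K M y) t
      (exp (real K * ln Z) \<le> exp (real K * y) / r) (r * exp (real K * y) \<le> exp (real K * ln Z))"
    using decides Kn(1) \<open>r > 1\<close> copies_uniform_models[OF M, of K]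
    unfolding decides_within_def query_def r_def uniform_models_order[OF M] Z_copies[symmetric]
    by blast
  have ratio: "c * ln (real (K * n)) \<le> real K * (\<rho> / 20)"
    unfolding K_def using assms(2,3) c_pos by (rule ln_ratio_le_copy_count)
  have "answers p (query c K M y) t (displacement \<rho> Z y \<ge> 1) (displacement \<rho> Z y \<le> -1)"
    using t(2) unfolding r
    by (elim answers_mono)
      (use ratio assms(3) in \<open>auto intro: displacement_ge_1D displacement_le_minus_1D\<close>)
  with t(1) show ?thesis
    by (intro exI[of _ t]) (simp add: le_nat_floor)
qed

definition ln_bound :: real where
  "ln_bound = ln (real q) + \<bar>b\<bar> + h"

definition search_time :: "nat \<Rightarrow> real \<Rightarrow> nat" where
  "search_time n \<rho> = query_count ln_bound n \<rho>
     * (2 * m + nat \<lfloor>C * real (copy_count c n \<rho> * n) ^ k\<rfloor> + 10) + 3"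

definition approximator_time :: "nat \<Rightarrow> real \<Rightarrow> nat" where
  "approximator_time n \<rho> = 5 * n
     + copy_count c n \<rho> * (add_copy_time (copy_count c n \<rho> * n) + 4) + search_time n \<rho> + 26"

lemma poly_bounded_approximator_time: "poly_bounded (\<lambda>n \<rho>. real (approximator_time n \<rho>))"
  unfolding approximator_time_def search_time_def add_copy_time_def of_nat_add of_nat_mult
  by (intro poly_bounded_intros poly_bounded_nat_floor poly_bounded_copy_count poly_bounded_query_count)

lemma wp_search_le:
  assumes M: "M \<in> uniform_models q d b h n" and "n \<ge> 1" "\<rho> > 0"
    and s: "search_ready c \<rho> (copy_count c n \<rho>) M s" "s v_y = Atom 0"
      "s v_lim = Atom (200 * ln_bound * (real n * real n) / \<rho>)"
  defines "Z \<equiv> partition_function M"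
  shows "wp (search_time n \<rho> + 2) (search p) (\<lambda>s. indicator (- approximations \<rho> Z) (s 0)) s
    \<le> ennreal (1/4)"
proof -
  let ?error = "\<lambda>s. indicator (- approximations \<rho> Z) (s 0) :: ennreal"
  let ?output = "Assign 0 (Exp (Var v_y))"
  have "wp (search_time n \<rho> + 1 + 1) (search p) ?error s
      \<le> wp (search_time n \<rho>) (count_to v_i v_lim (search_step p)) (wp 1 ?output ?error) s"
    unfolding search_def by (rule wp_Seq)
  also have "\<dots>
      \<le> ennreal (failure_bound (query_count ln_bound n \<rho>) (displacement \<rho> Z (num (s v_y))))"
    unfolding search_time_def query_count_def
  proof (rule wp_count_to_search_step_le[OF vars_below assms(3) s(1,3)])
    show "\<exists>t\<le>nat \<lfloor>C * real (copy_count c n \<rho> * n) ^ k\<rfloor>. answers p (query c (copy_count c n \<rho>) M y) t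
        (displacement \<rho> Z y \<ge> 1) (displacement \<rho> Z y \<le> -1)" for y
      unfolding Z_def by (rule answers_query[OF M assms(2,3)])
    show "wp 1 ?output ?error s'
        \<le> ennreal (failure_bound 0 (displacement \<rho> Z (num (s' v_y))))" for s'
      using indicator_le_failure_bound partition_function_pos[OF M q_pos] assms(3)
      by (simp add: wp_Assign Z_def)
  qed
  also have "\<dots> \<le> ennreal (1/4)"
    using failure_bound_query_count_le abs_ln_partition_function_le[OF M q_pos h_nonneg] assms(3)
    by (intro ennreal_leI) (simp add: s(2) Z_def ln_bound_def)
  finally show ?thesis by simp
qed

lemma wp_approximator_le:
  assumes M: "M \<in> uniform_models q d b h n" and n: "n \<ge> 1" and \<rho>: "\<rho> > 0"
  shows "wp (approximator_time n \<rho>) (approximator c ln_bound p)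
    (\<lambda>s. indicator (- approximations \<rho> (partition_function M)) (s 0))
    (initial (Pair (Atom \<rho>) (encode M))) \<le> ennreal (1/4)"
proof -
  define K where "K = copy_count c n \<rho>"
  let ?error = "\<lambda>s. indicator (- approximations \<rho> (partition_function M)) (s 0) :: ennreal"
  let ?inp = "initial (Pair (Atom \<rho>) (encode M))"
  let ?copies_made = "\<lambda>s. input_read \<rho> M s \<and> s v_K = Atom (real K) \<and> s v_out = encode (copies K M)"
  have order: "order M = n" and simple: "simple M"
    using M by (rule uniform_models_order, rule uniform_models_simple)
  have "K * n > 0"
    using copy_count_ge_2[of c n \<rho>] n by (simp add: K_def)
  then have search: "wp (5 + (search_time n \<rho> + 2) + 1)
      (Seq (start_search c ln_bound) (search p)) ?error s \<le> ennreal (1/4)" if "?copies_made s" for s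
    using that order wp_search_le[OF M n \<rho>]
    by (intro wp_Seq_le_if_ensures[OF ensures_start_search[of \<rho> M s K c ln_bound]])
      (auto simp: K_def)
  have copy: "wp (K * (add_copy_time (K * n) + 4) + 7 + (5 + (search_time n \<rho> + 2) + 1) + 1)
      (Seq (make_copies c) (Seq (start_search c ln_bound) (search p))) ?error s \<le> ennreal (1/4)"
    if "input_read \<rho> M s" for s
    using ensures_make_copies[OF that simple, of c] search unfolding K_def order
    by (rule wp_Seq_le_if_ensures)
  let ?t = "5 * n + 9 + (K * (add_copy_time (K * n) + 4) + 7 + (5 + (search_time n \<rho> + 2) + 1) + 1) + 1"
  have "ensures (5 * n + 9) read_input (input_read \<rho> M) ?inp"
    using ensures_read_input[of ?inp \<rho> M] by (simp add: order)
  then have "wp ?t (approximator c ln_bound p) ?error ?inp \<le> ennreal (1/4)"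
    unfolding approximator_def using copy by (rule wp_Seq_le_if_ensures)
  moreover have "?t = approximator_time n \<rho>"
    by (simp add: approximator_time_def K_def)
  ultimately show ?thesis by (simp only:)
qed

lemma fpras_approximator: "fpras (uniform_models q d b h) (approximator c ln_bound p)"
proof -
  obtain C' k' where time:
    "\<And>n \<rho>. n \<ge> 1 \<Longrightarrow> \<rho> > 0 \<Longrightarrow> real (approximator_time n \<rho>) \<le> C' * (real n + 1 / \<rho>) ^ k'"
    using poly_bounded_approximator_time unfolding poly_bounded_def by auto
  show ?thesis
    unfolding fpras_def Let_def
  proof (intro exI allI ballI impI conjI)
    fix n M and \<rho> :: real assume n: "1 \<le> n" and M: "M \<in> uniform_models q d b h n" and \<rho>: "0 < \<rho>"
    note error = wp_approximator_le[OF M n \<rho>]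
    show "real (approximator_time n \<rho>) \<le> C' * (real n + 1 / \<rho>) ^ k'"
      using n \<rho> by (rule time)
    show "halts_within (approximator c ln_bound p) (Pair (Atom \<rho>) (encode M)) (approximator_time n \<rho>)"
      using halts_within_if_wp_le[OF error] by simp
    show "3/4 \<le> measure_pmf.prob
        (output_dist (approximator c ln_bound p) (Pair (Atom \<rho>) (encode M)) (approximator_time n \<rho>))
        {Atom z | z. exp (- \<rho>) * partition_function M \<le> z \<and> z \<le> exp \<rho> * partition_function M}"
      using prob_output_ge_if_wp_le[OF error] by (simp add: approximations_def)
  qed
qed

end

theorem fpras_if_poly_time_decision:
  assumes "q \<ge> 1" "h \<ge> 0" "c > 0"
    and "poly_time_decision (uniform_models q d b h) (\<lambda>n. real n powr c) p"
  shows "\<exists>p'. fpras (uniform_models q d b h) p'"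
proof -
  obtain C k where decides:
    "decides_within (uniform_models q d b h) (\<lambda>n. real n powr c) p (\<lambda>n. C * real n ^ k)"
    using assms(4) unfolding poly_time_decision_iff_decides_within by blast
  obtain m where "cvars p \<subseteq> {..<m}"
    using finite_nat_bounded[OF finite_cvars] by blast
  then have "cvars p \<subseteq> {..<Suc m}" by auto
  with assms(1-3) decides interpret decision_procedure "Suc m" q d k b h c C p
    by unfold_locales auto
  show ?thesis using fpras_approximator by blast
qed

lemma potts_plus_eq_uniform_models: "\<beta> \<ge> 0 \<Longrightarrow> potts_plus q n d \<beta> h = uniform_models q d \<beta> h n"
  by (auto simp: potts_plus_def uniform_models_def ferromagnetic_def)

lemma ising_minus_eq_uniform_models: "\<beta> \<ge> 0 \<Longrightarrow> ising_minus n d \<beta> h = uniform_models 2 d (- \<beta>) h n"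
  by (auto simp: ising_minus_def uniform_models_def antiferromagnetic_def)

theorem theorem2p4:
  fixes q d :: nat and \<beta> h :: real and \<M> :: "nat \<Rightarrow> potts set"
  assumes "q \<ge> 2" and "d \<ge> 1" and "\<beta> \<ge> 0" and "h \<ge> 0"
    and "\<M> \<in> {\<lambda>n. potts_plus q n d \<beta> h, \<lambda>n. ising_minus n d \<beta> h, \<lambda>n. ising_plus n d \<beta> h}"
    and "\<not> (\<exists>p. fpras \<M> p)"
  shows "\<forall>c>0. \<not> (\<exists>p. poly_time_decision \<M> (\<lambda>n. real n powr c) p)"
proof -
  have "\<M> \<in> {uniform_models q d \<beta> h, uniform_models 2 d (- \<beta>) h, uniform_models 2 d \<beta> h}"
    using assms(3,5)
    by (simp add: ising_plus_def potts_plus_eq_uniform_models ising_minus_eq_uniform_models)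
  then obtain q' b where "q' \<ge> 1" and \<M>: "\<M> = uniform_models q' d b h"
    using assms(1) by (elim insertE emptyE) (auto intro: that[of q] that[of 2])
  with fpras_if_poly_time_decision assms(4,6) show ?thesis
    by blast
qed

end
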